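(* Assume that $d\ge 5$, and let $l_\infty$ and $\tilde l_\infty$ be the infinite-time local times of two independent aperiodic simple random walks on $\mathbb{Z}^d$, both started at $0$. For $q\le 2$, set $$\zeta(q)=\sum_{z\in\mathbb{Z}^d} l_\infty(z)\,\tilde l_\infty(z)^{\,q-1}.$$ For any $q$ with $2\ge q>\frac{d}{d-2}$, there is $\kappa_q>0$ such that, for $t>0$, $$\mathbb{P}\big(\zeta(q)>t\big)\le \exp\big(-\kappa_q\, t^{1/q}\big).$$
   Context: The aperiodic simple random walk on $\mathbb{Z}^d$ is the Markov chain for which, given $S_n$, the position $S_{n+1}$ is uniform on the $2d+1$ sites $\{z\in\mathbb{Z}^d:\ |z-S_n|\le 1\}$, where $|z|=|z_1|+\dots+|z_d|$. $(S_n)$ and $(\tilde S_n)$ are two independent such walks started at $0$, and $\mathbb{P}=P_0\otimes\tilde P_0$ is their joint law. Local times: $l_\infty(z)=\sum_{k=0}^\infty\mathbf{1}\{S_k=z\}$ and $\tilde l_\infty(z)=\sum_{k=0}^\infty\mathbf{1}\{\tilde S_k=z\}$.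
   Formalization: The bound is stated for t ≥ 1 instead of t > 0: since both walks start at 0 and time 0 is counted, ζ(q) ≥ 1 almost surely, so P(ζ(q) > t) = 1 for 0 < t < 1 and the printed bound fails there for every κ_q > 0. *)

theory Defs
  imports "HOL-Probability.Probability"
begin

definition l1_norm :: "int ^ 'd::finite \<Rightarrow> int" where
  "l1_norm z = (\<Sum>i\<in>UNIV. \<bar>z $ i\<bar>)"

definition srw_step :: "int ^ 'd::finite \<Rightarrow> (int ^ 'd) pmf" where
  "srw_step x = pmf_of_set {z. l1_norm (z - x) \<le> 1}"

text \<open>The set in \<^const>\<open>srw_step\<close> is finite and nonempty, so \<^const>\<open>pmf_of_set\<close> is the
  uniform distribution on it.\<close>

lemma finite_srw_step: "finite {z :: int ^ 'd::finite. l1_norm (z - x) \<le> 1}"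
proof -
  have "{z. l1_norm (z - x) \<le> 1} \<subseteq> vec_lambda ` (PiE UNIV (\<lambda>i. {x $ i - 1 .. x $ i + 1}))"
  proof
    fix z assume "z \<in> {z. l1_norm (z - x) \<le> 1}"
    then have *: "(\<Sum>i\<in>UNIV. \<bar>(z - x) $ i\<bar>) \<le> 1"
      by (simp add: l1_norm_def)
    have "\<bar>z $ i - x $ i\<bar> \<le> 1" for i
      using member_le_sum[of i UNIV "\<lambda>i. \<bar>(z - x) $ i\<bar>"] * by simp
    then have "z $ i \<in> {x $ i - 1 .. x $ i + 1}" for i
      by (smt (verit) atLeastAtMost_iff)
    then show "z \<in> vec_lambda ` (PiE UNIV (\<lambda>i. {x $ i - 1 .. x $ i + 1}))"
      by (intro image_eqI[of _ _ "vec_nth z"]) auto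
  qed
  then show ?thesis
    by (rule finite_subset) (intro finite_imageI finite_PiE; simp)
qed

lemma srw_step_nonempty: "{z :: int ^ 'd::finite. l1_norm (z - x) \<le> 1} \<noteq> {}"
proof -
  have "x \<in> {z. l1_norm (z - x) \<le> 1}"
    by (simp add: l1_norm_def)
  then show ?thesis by blast
qed

definition aperiodic_srw :: "'a measure \<Rightarrow> (nat \<Rightarrow> 'a \<Rightarrow> int ^ 'd::finite) \<Rightarrow> bool" where
  "aperiodic_srw M S \<longleftrightarrow>
     prob_space M \<and>
     (\<forall>n. S n \<in> M \<rightarrow>\<^sub>M count_space UNIV) \<and>
     (AE \<omega> in M. S 0 \<omega> = 0) \<and>
     (\<forall>n x y. measure M {\<omega> \<in> space M. (\<forall>k\<le>n. S k \<omega> = x k) \<and> S (Suc n) \<omega> = y} =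
              measure M {\<omega> \<in> space M. \<forall>k\<le>n. S k \<omega> = x k} * pmf (srw_step (x n)) y)"

definition two_indep_srw ::
    "'a measure \<Rightarrow> (nat \<Rightarrow> 'a \<Rightarrow> int ^ 'd::finite) \<Rightarrow> (nat \<Rightarrow> 'a \<Rightarrow> int ^ 'd) \<Rightarrow> bool" where
  "two_indep_srw M S S' \<longleftrightarrow>
     aperiodic_srw M S \<and> aperiodic_srw M S' \<and>
     prob_space.indep_var M
       (PiM UNIV (\<lambda>_. count_space UNIV)) (\<lambda>\<omega> n. S n \<omega>)
       (PiM UNIV (\<lambda>_. count_space UNIV)) (\<lambda>\<omega> n. S' n \<omega>)"

text \<open>A local time may be infinite (on a null set of paths when the walk is transient), so it
  takes values in \<^typ>\<open>ennreal\<close>.\<close>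

definition local_time :: "(nat \<Rightarrow> int ^ 'd::finite) \<Rightarrow> int ^ 'd \<Rightarrow> ennreal" where
  "local_time x z = (\<Sum>k. indicator {z} (x k))"

text \<open>Real powers on \<^typ>\<open>ennreal\<close>, meant for exponents \<open>p > 0\<close>; in particular
  \<open>0\<close> is mapped to \<open>0\<close>.\<close>

definition ennpowr :: "ennreal \<Rightarrow> real \<Rightarrow> ennreal" where
  "ennpowr a p = (if a = \<top> then \<top> else ennreal (enn2real a powr p))"

definition zeta :: "real \<Rightarrow> (nat \<Rightarrow> int ^ 'd::finite) \<Rightarrow> (nat \<Rightarrow> int ^ 'd) \<Rightarrow> ennreal" where
  "zeta q x y = (\<Sum>\<^sub>\<infinity>z\<in>UNIV. local_time x z * ennpowr (local_time y z) (q - 1))"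

text \<open>Time \<open>0\<close> is counted, so two paths started at \<open>0\<close> have \<open>zeta q \<ge> 1\<close>. Hence
  \<open>zeta q > t\<close> is an almost sure event for every \<open>t < 1\<close>, and a tail bound of the form
  \<open>exp (- \<kappa> t\<^bsup>1/q\<^esup>)\<close> with prefactor \<open>1\<close> and \<open>\<kappa> > 0\<close> is possible only for \<open>t \<ge> 1\<close>.\<close>

lemma local_time_start: "1 \<le> local_time x (x 0)"
proof -
  have "(\<Sum>k<1. indicator {x 0} (x k)) \<le> local_time x (x 0)"
    unfolding local_time_def by (rule sum_le_suminf) auto
  then show ?thesis by simp
qed

lemma zeta_ge_1:
  assumes "x 0 = 0" "y 0 = 0" "1 < q"
  shows "1 \<le> zeta q x y"
proof -
  have lx: "1 \<le> local_time x 0" and ly: "1 \<le> local_time y 0"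
    using local_time_start[of x] local_time_start[of y] assms by simp_all
  have "1 \<le> ennpowr (local_time y 0) (q - 1)"
  proof (cases "local_time y 0")
    case (real r)
    then have "1 \<le> r" using ly by simp
    then have "1 \<le> r powr (q - 1)" using assms(3) by (simp add: ge_one_powr_ge_zero)
    then show ?thesis using real by (simp add: ennpowr_def)
  qed (simp add: ennpowr_def)
  then have "1 * 1 \<le> local_time x 0 * ennpowr (local_time y 0) (q - 1)"
    using lx by (intro mult_mono) auto
  also have "\<dots> = (\<Sum>z\<in>{0}. local_time x z * ennpowr (local_time y z) (q - 1))"
    by simp
  also have "\<dots> \<le> zeta q x y"
    unfolding zeta_def infsum_finite[OF finite.insertI[OF finite.emptyI], symmetric]
    by (rule infsum_mono_neutral) (auto intro!: nonneg_summable_on_complete)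
  finally show ?thesis by simp
qed

end

theory Submission
  imports Defs
begin

text \<open>
  Let \<open>A(z\<^sub>1, \<dots>, z\<^sub>n)\<close> be the expectation of \<open>l\<^sub>\<infinity>(z\<^sub>1) \<cdots> l\<^sub>\<infinity>(z\<^sub>n)\<close>. By independence and Jensen's inequality
  for the concave power \<open>q - 1\<close>, the \<open>n\<close>-th moment of \<open>\<zeta>(q)\<close> is at most the sum of \<open>A\<^sup>q\<close> over all
  \<open>n\<close>-tuples of sites. Ordering the visit times bounds \<open>A\<close> by the sum, over all permutations of
  the sites, of products of Green functions along the permuted tuple; convexity of the power \<open>q\<close>
  then gives the moment bound \<open>(n!)\<^sup>q K\<^sup>n\<close> with \<open>K\<close> the sum of \<open>G\<^sup>q\<close>, and Markov's inequality with
  \<open>n \<approx> t\<^bsup>1/q\<^esup>\<close> the tail bound up to a constant factor. That \<open>G\<close> is in \<open>\<ell>\<^sup>q\<close> follows from the decay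
  \<open>k\<^bsup>-d/2\<^esup>\<close> of the \<open>k\<close>-step transition probabilities; \<open>q > d/(d - 2)\<close> is exactly what makes the
  sum over \<open>k\<close> of their \<open>\<ell>\<^sup>q\<close> norms converge.

  The constant factor is removed by showing that \<open>\<zeta>(q) \<le> 1\<close> has probability bounded below: let the
  walks first run \<open>m\<close> steps in opposite directions; for \<open>d \<ge> 5\<close> the expected number of later
  encounters is then small once \<open>m\<close> is large.
\<close>

subsection \<open>Powers and sums of extended nonnegative reals\<close>

lemma ennpowr_ennreal: "0 \<le> x \<Longrightarrow> ennpowr (ennreal x) p = ennreal (x powr p)"
  by (simp add: ennpowr_def)

lemma ennpowr_0 [simp]: "ennpowr 0 p = 0"
  by (simp add: ennpowr_def)

lemma ennpowr_top [simp]: "ennpowr \<top> p = \<top>"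
  by (simp add: ennpowr_def)

lemma ennpowr_1 [simp]: "ennpowr 1 p = 1"
  by (simp add: ennpowr_def)

lemma ennpowr_by_1 [simp]: "ennpowr a 1 = a"
  by (cases a) (simp_all add: ennpowr_ennreal)

lemma measurable_ennpowr [measurable]: "(\<lambda>a. ennpowr a p) \<in> borel_measurable borel"
  unfolding ennpowr_def by measurable

lemma ennpowr_mono: "a \<le> b \<Longrightarrow> 0 \<le> p \<Longrightarrow> ennpowr a p \<le> ennpowr b p"
  by (cases a; cases b) (auto simp: ennpowr_ennreal powr_mono2 top_unique)

lemma ennpowr_mult: "ennpowr (a * b) p = ennpowr a p * ennpowr b p"
proof (cases "a = 0 \<or> b = 0")
  case False
  then show ?thesis
    by (cases a; cases b)
      (auto simp: ennpowr_ennreal ennreal_mult[symmetric] ennreal_mult_top ennreal_top_mult powr_mult)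
qed auto

lemma ennpowr_ennpowr: "ennpowr (ennpowr a p) r = ennpowr a (p * r)"
  by (cases a) (simp_all add: ennpowr_ennreal powr_powr)

lemma ennpowr_add: "0 < p \<Longrightarrow> 0 < r \<Longrightarrow> ennpowr a (p + r) = ennpowr a p * ennpowr a r"
  by (cases a) (simp_all add: ennpowr_ennreal powr_add ennreal_mult[symmetric] ennreal_top_mult)

lemma ennpowr_prod_list: "ennpowr (prod_list as) p = prod_list (map (\<lambda>a. ennpowr a p) as)"
  by (induction as) (simp_all add: ennpowr_mult)

text \<open>Young's inequality for \<open>x\<close> and \<open>y powr (q - 1)\<close> with the
  conjugate exponents \<open>q\<close> and \<open>q / (q - 1)\<close>. This tangent-line form of
  convexity can be integrated pointwise.\<close>

lemma powr_tangent:
  fixes x y q :: real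
  assumes "0 \<le> x" "0 < y" "1 < q"
  shows "q * y powr (q - 1) * x \<le> x powr q + (q - 1) * y powr q"
proof -
  have "x * y powr (q - 1) \<le> x powr q / q + (y powr (q - 1)) powr (q / (q - 1)) / (q / (q - 1))"
    by (rule Youngs_inequality) (use assms in \<open>auto simp: field_simps\<close>)
  also have "(y powr (q - 1)) powr (q / (q - 1)) = y powr q"
    using assms by (simp add: powr_powr)
  finally have "q * (x * y powr (q - 1)) \<le> q * (x powr q / q + y powr q / (q / (q - 1)))"
    using assms by (intro mult_left_mono) auto
  moreover have "q * (x powr q / q + y powr q / (q / (q - 1))) = x powr q + (q - 1) * y powr q"
    using assms by (simp add: distrib_left)
  ultimately show ?thesis by (simp add: mult_ac)
qed

text \<open>Integrate the tangent inequality and choose the best point of tangency. The total mass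
  \<open>m\<close> is kept general so that finite sums, weighted series and probability measures are
  all covered.\<close>

lemma jensen_ennpowr:
  assumes f [measurable]: "f \<in> borel_measurable M"
    and m: "emeasure M (space M) = ennreal m" "0 < m" and q: "1 \<le> q"
  shows "ennpowr (\<integral>\<^sup>+x. f x \<partial>M) q \<le> ennreal (m powr (q - 1)) * (\<integral>\<^sup>+x. ennpowr (f x) q \<partial>M)"
proof (cases "q = 1")
  case True
  then show ?thesis using m by simp
next
  case False
  then have q: "1 < q" using q by simp
  let ?J = "\<integral>\<^sup>+x. ennpowr (f x) q \<partial>M"
  have tangent: "ennreal (q * y powr (q - 1)) * (\<integral>\<^sup>+x. f x \<partial>M) \<le> ?J + ennreal ((q - 1) * y powr q * m)"
    if y: "0 < y" for y
  proof -
    have "ennreal (q * y powr (q - 1)) * (\<integral>\<^sup>+x. f x \<partial>M)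
        = (\<integral>\<^sup>+x. ennreal (q * y powr (q - 1)) * f x \<partial>M)"
      by (simp add: nn_integral_cmult)
    also have "\<dots> \<le> (\<integral>\<^sup>+x. ennpowr (f x) q + ennreal ((q - 1) * y powr q) \<partial>M)"
    proof (rule nn_integral_mono)
      fix x
      show "ennreal (q * y powr (q - 1)) * f x \<le> ennpowr (f x) q + ennreal ((q - 1) * y powr q)"
        using powr_tangent[OF _ y q] y q
        by (cases "f x") (auto simp: ennpowr_ennreal ennreal_mult[symmetric] simp flip: ennreal_plus)
    qed
    also have "\<dots> = ?J + ennreal ((q - 1) * y powr q * m)"
      using m q by (subst nn_integral_add) (auto simp: ennreal_mult[symmetric])
    finally show ?thesis .
  qed
  show ?thesis
  proof (cases "?J = \<top>")
    case True
    then show ?thesis using m by (simp add: ennreal_mult_top)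
  next
    case J: False
    then obtain j where j: "?J = ennreal j" "0 \<le> j" by (cases ?J) auto
    \<comment> \<open>When the right-hand integral is finite, any single tangent shows that the
      integral of \<open>f\<close> is finite; the one at \<open>1\<close> is used.\<close>
    have "ennreal (q * 1 powr (q - 1)) * (\<integral>\<^sup>+x. f x \<partial>M) < \<top>"
      using tangent[of 1] J by (auto simp: less_top[symmetric] top_unique)
    then obtain i where i: "(\<integral>\<^sup>+x. f x \<partial>M) = ennreal i" "0 \<le> i"
      using q by (cases "\<integral>\<^sup>+x. f x \<partial>M") (auto simp: ennreal_mult_top)
    show ?thesis
    proof (cases "i = 0")
      case True
      then show ?thesis using i by simp
    next
      case False
      then have "0 < i" using i by simp
      \<comment> \<open>The mean of \<open>f\<close>: at this point both sides of the integrated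
        tangent inequality are expressed through \<open>y powr q * m\<close>.\<close>
      define y where "y = i / m"
      have y: "0 < y" using \<open>0 < i\<close> m by (simp add: y_def)
      have "ennreal (q * y powr (q - 1) * i) \<le> ennreal (j + (q - 1) * y powr q * m)"
        using tangent[OF y] i j q m y by (simp add: ennreal_mult[symmetric] flip: ennreal_plus)
      then have "q * y powr (q - 1) * i \<le> j + (q - 1) * y powr q * m"
        using j q m y by (subst (asm) ennreal_le_iff) auto
      moreover have "y powr (q - 1) * i = y powr q * m"
        using y m \<open>0 < i\<close> by (simp add: y_def powr_diff)
      ultimately have "q * (y powr q * m) \<le> j + (q - 1) * (y powr q * m)" by (metis mult.assoc)
      then have "y powr q * m \<le> j" by (simp add: left_diff_distrib)
      then have "m powr (q - 1) * (y powr q * m) \<le> m powr (q - 1) * j"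
        by (intro mult_left_mono) auto
      moreover have "m powr (q - 1) * (y powr q * m) = i powr q"
        using m \<open>0 < i\<close> by (simp add: y_def powr_divide powr_diff)
      ultimately show ?thesis
        using i j by (simp add: ennpowr_ennreal ennreal_mult[symmetric])
    qed
  qed
qed

text \<open>The convex Jensen inequality with exponent \<open>1 / p\<close>, applied to
  \<open>ennpowr (f x) p\<close> and then raised to the power \<open>p\<close>.\<close>

lemma (in prob_space) nn_integral_ennpowr_le:
  assumes [measurable]: "f \<in> borel_measurable M" and p: "0 < p" "p \<le> 1"
  shows "(\<integral>\<^sup>+x. ennpowr (f x) p \<partial>M) \<le> ennpowr (\<integral>\<^sup>+x. f x \<partial>M) p"
proof -
  have "ennpowr (\<integral>\<^sup>+x. ennpowr (f x) p \<partial>M) (1 / p)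
      \<le> ennreal (1 powr (1 / p - 1)) * (\<integral>\<^sup>+x. ennpowr (ennpowr (f x) p) (1 / p) \<partial>M)"
    using p by (intro jensen_ennpowr) (auto simp: emeasure_space_1)
  then have "ennpowr (\<integral>\<^sup>+x. ennpowr (f x) p \<partial>M) (1 / p) \<le> (\<integral>\<^sup>+x. f x \<partial>M)"
    using p by (simp add: ennpowr_ennpowr)
  from ennpowr_mono[OF this, of p] show ?thesis
    using p by (simp add: ennpowr_ennpowr)
qed

lemma ennpowr_sum_le:
  assumes "finite A" "A \<noteq> {}" "1 \<le> q"
  shows "ennpowr (\<Sum>i\<in>A. f i) q \<le> ennreal (real (card A) powr (q - 1)) * (\<Sum>i\<in>A. ennpowr (f i) q)"
  using jensen_ennpowr[of f "count_space A" "real (card A)" q] assms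
  by (simp add: nn_integral_count_space_finite card_gt_0_iff ennreal_of_nat_eq_real_of_nat)

section \<open>Sums and products of sums as integrals over counting measures\<close>

lemma infsum_le_nn_integral_count_space:
  fixes f :: "'a \<Rightarrow> ennreal"
  shows "infsum f UNIV \<le> (\<integral>\<^sup>+x. f x \<partial>count_space UNIV)"
proof -
  have "infsum f UNIV = (SUP F\<in>{F. finite F \<and> F \<subseteq> UNIV}. sum f F)"
    by (rule nonneg_infsum_complete) simp
  also have "\<dots> \<le> (\<integral>\<^sup>+x. f x \<partial>count_space UNIV)"
  proof (rule SUP_least)
    fix F assume "F \<in> {F. finite F \<and> F \<subseteq> (UNIV :: 'a set)}"
    then have "sum f F = (\<integral>\<^sup>+x. f x \<partial>count_space F)"
      by (simp add: nn_integral_count_space_finite)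
    also have "\<dots> \<le> (\<integral>\<^sup>+x. f x \<partial>count_space UNIV)"
      by (subst nn_integral_count_space_indicator) (auto intro!: nn_integral_mono split: split_indicator)
    finally show "sum f F \<le> (\<integral>\<^sup>+x. f x \<partial>count_space UNIV)" .
  qed
  finally show ?thesis .
qed

lemma measurable_nn_integral_count_space [measurable (raw)]:
  fixes f :: "'a :: countable \<Rightarrow> 'b \<Rightarrow> ennreal"
  assumes [measurable]: "\<And>x. f x \<in> borel_measurable M"
  shows "(\<lambda>w. \<integral>\<^sup>+x. f x w \<partial>count_space A) \<in> borel_measurable M"
proof -
  interpret sigma_finite_measure "count_space A"
    by (rule sigma_finite_measure_count_space_countable) simp
  have "case_prod (\<lambda>w x. f x w) \<in> borel_measurable (M \<Otimes>\<^sub>M count_space A)"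
    by (subst measurable_pair_swap_iff) (auto intro!: measurable_pair_measure_countable1)
  then show ?thesis
    by (rule borel_measurable_nn_integral)
qed

lemma nn_integral_count_space_Suc_length:
  "(\<integral>\<^sup>+xs. F xs \<partial>count_space {xs. length xs = Suc n}) =
   (\<integral>\<^sup>+x. (\<integral>\<^sup>+xs. F (x # xs) \<partial>count_space {xs. length xs = n}) \<partial>count_space UNIV)"
proof -
  let ?B = "{xs :: 'a list. length xs = n}"
  have bij: "bij_betw (\<lambda>(x, xs). x # xs) (UNIV \<times> ?B) {xs. length xs = Suc n}"
    by (rule bij_betwI[where g = "\<lambda>xs. (hd xs, tl xs)"]) (auto simp: length_Suc_conv)
  have "(\<integral>\<^sup>+xs. F xs \<partial>count_space {xs. length xs = Suc n})
      = (\<integral>\<^sup>+p. F (case p of (x, xs) \<Rightarrow> x # xs) \<partial>count_space (UNIV \<times> ?B))"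
    by (rule nn_integral_bij_count_space[OF bij, symmetric])
  also have "\<dots> = (\<integral>\<^sup>+p. F (case p of (x, xs) \<Rightarrow> x # xs) * indicator (UNIV \<times> ?B) p \<partial>count_space UNIV)"
    by (subst nn_integral_count_space_indicator) auto
  also have "\<dots> = (\<integral>\<^sup>+x. \<integral>\<^sup>+xs. F (x # xs) * indicator (UNIV \<times> ?B) (x, xs) \<partial>count_space UNIV \<partial>count_space UNIV)"
    by (subst nn_integral_fst_count_space[symmetric]) simp
  also have "\<dots> = (\<integral>\<^sup>+x. (\<integral>\<^sup>+xs. F (x # xs) \<partial>count_space ?B) \<partial>count_space UNIV)"
    by (subst (2) nn_integral_count_space_indicator) (auto intro!: nn_integral_cong split: split_indicator)
  finally show ?thesis .
qed

lemma nn_integral_count_space_length_0: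
  "(\<integral>\<^sup>+xs. F xs \<partial>count_space {xs. length xs = 0}) = F []"
  by (simp add: nn_integral_count_space_finite)

text \<open>Distributivity, one factor at a time. With \<open>zs\<close> a list of sites and
  \<open>ks\<close> a list of times, it turns a product of local times into a sum over lists of
  visit times.\<close>

lemma prod_list_nn_integral_count_space:
  "prod_list (map (\<lambda>z. \<integral>\<^sup>+k. f z k \<partial>count_space UNIV) zs) =
   (\<integral>\<^sup>+ks. prod_list (map2 f zs ks) \<partial>count_space {ks. length ks = length zs})"
proof (induction zs)
  case (Cons z zs)
  then show ?case
    by (simp only: nn_integral_count_space_Suc_length list.size add_Suc_right add_0_right list.map prod_list.Cons zip_Cons_Cons prod.case)
       (simp add: nn_integral_cmult nn_integral_multc)
qed (simp add: nn_integral_count_space_length_0[simplified])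

lemma power_nn_integral_count_space:
  "(\<integral>\<^sup>+z. f z \<partial>count_space UNIV) ^ n =
   (\<integral>\<^sup>+zs. prod_list (map f zs) \<partial>count_space {zs. length zs = n})"
proof (induction n)
  case (Suc n)
  then show ?case
    by (simp add: nn_integral_count_space_Suc_length nn_integral_cmult nn_integral_multc)
qed (simp add: nn_integral_count_space_length_0[simplified])

text \<open>Independence makes the joint law a product measure, and Tonelli's theorem splits the
  integral; infinite values are allowed throughout.\<close>

lemma (in prob_space) indep_var_nn_integral_mult:
  assumes ind: "indep_var N X L Y"
    and [measurable]: "f \<in> borel_measurable N" "g \<in> borel_measurable L"
  shows "(\<integral>\<^sup>+w. f (X w) * g (Y w) \<partial>M) = (\<integral>\<^sup>+w. f (X w) \<partial>M) * (\<integral>\<^sup>+w. g (Y w) \<partial>M)"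
proof -
  have [measurable]: "X \<in> M \<rightarrow>\<^sub>M N" "Y \<in> M \<rightarrow>\<^sub>M L"
    and eq: "distr M N X \<Otimes>\<^sub>M distr M L Y = distr M (N \<Otimes>\<^sub>M L) (\<lambda>w. (X w, Y w))"
    using ind by (auto simp: indep_var_distribution_eq)
  interpret Y: prob_space "distr M L Y" by (rule prob_space_distr) simp
  have "(\<integral>\<^sup>+w. f (X w) * g (Y w) \<partial>M) = (\<integral>\<^sup>+p. f (fst p) * g (snd p) \<partial>distr M (N \<Otimes>\<^sub>M L) (\<lambda>w. (X w, Y w)))"
    by (subst nn_integral_distr) auto
  also have "\<dots> = (\<integral>\<^sup>+x. \<integral>\<^sup>+y. f x * g y \<partial>distr M L Y \<partial>distr M N X)"
    unfolding eq[symmetric] by (subst Y.nn_integral_fst[symmetric]) auto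
  also have "\<dots> = (\<integral>\<^sup>+x. f x \<partial>distr M N X) * (\<integral>\<^sup>+y. g y \<partial>distr M L Y)"
    by (simp add: nn_integral_cmult nn_integral_multc)
  also have "\<dots> = (\<integral>\<^sup>+w. f (X w) \<partial>M) * (\<integral>\<^sup>+w. g (Y w) \<partial>M)"
    by (simp add: nn_integral_distr)
  finally show ?thesis .
qed

subsection \<open>Decay of the transition probabilities\<close>

lemma l1_norm_axis: "l1_norm (axis i a :: int ^ 'd::finite) = \<bar>a\<bar>"
  by (simp add: l1_norm_def axis_def if_distrib[of abs] cong: if_cong)

lemma l1_ball_eq:
  "{e :: int ^ 'd::finite. l1_norm e \<le> 1} = insert 0 (range (\<lambda>i. axis i 1) \<union> range (\<lambda>i. axis i (- 1)))"
proof (intro subset_antisym subsetI)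
  fix e :: "int ^ 'd"
  assume "e \<in> {e. l1_norm e \<le> 1}"
  then have le: "(\<Sum>i\<in>UNIV. \<bar>e $ i\<bar>) \<le> 1" by (simp add: l1_norm_def)
  show "e \<in> insert 0 (range (\<lambda>i. axis i 1) \<union> range (\<lambda>i. axis i (- 1)))"
  proof (cases "e = 0")
    case False
    then obtain i where i: "e $ i \<noteq> 0" by (auto simp: vec_eq_iff)
    have "\<bar>e $ i\<bar> + (\<Sum>j\<in>UNIV - {i}. \<bar>e $ j\<bar>) \<le> 1"
      using le by (simp add: sum.remove[of UNIV i])
    moreover have "0 \<le> (\<Sum>j\<in>UNIV - {i}. \<bar>e $ j\<bar>)" by (simp add: sum_nonneg)
    ultimately have "\<bar>e $ i\<bar> = 1" and "(\<Sum>j\<in>UNIV - {i}. \<bar>e $ j\<bar>) = 0"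
      using i by linarith+
    then have "e = axis i (e $ i)" "e $ i = 1 \<or> e $ i = - 1"
      by (auto simp: sum_nonneg_eq_0_iff vec_eq_iff axis_def)
    then show ?thesis by (metis UnI1 UnI2 insertI2 rangeI)
  qed simp
next
  show "e \<in> {e. l1_norm e \<le> 1}"
    if "e \<in> insert 0 (range (\<lambda>i. axis i 1) \<union> range (\<lambda>i. axis i (- 1)))" for e :: "int ^ 'd"
    using that by (auto simp: l1_norm_def[of 0] l1_norm_axis)
qed

lemma finite_l1_ball: "finite {e :: int ^ 'd::finite. l1_norm e \<le> 1}"
  using finite_srw_step[of 0] by simp

lemma sum_l1_ball:
  fixes f :: "int ^ 'd::finite \<Rightarrow> 'b::comm_monoid_add"
  shows "(\<Sum>e | l1_norm e \<le> 1. f e) = f 0 + (\<Sum>i\<in>UNIV. f (axis i 1) + f (axis i (- 1)))"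
proof -
  have inj: "inj (\<lambda>i::'d. axis i a)" if "a \<noteq> 0" for a :: int
    using that by (auto simp: inj_def axis_eq_axis)
  have "(\<Sum>e | l1_norm e \<le> 1. f e)
      = f 0 + (sum f (range (\<lambda>i. axis i 1)) + sum f (range (\<lambda>i. axis i (- 1))))"
    unfolding l1_ball_eq
    by (subst sum.insert)
      (auto simp: axis_eq_0_iff axis_eq_axis eq_commute[of 0] intro!: arg_cong[of _ _ "(+) (f 0)"] sum.union_disjoint)
  then show ?thesis
    by (simp add: sum.reindex inj sum.distrib)
qed

lemma card_l1_ball: "card {e :: int ^ 'd::finite. l1_norm e \<le> 1} = 2 * CARD('d) + 1"
  using sum_l1_ball[of "\<lambda>_ :: int ^ 'd. 1::nat"] by simp

text \<open>The transition probability from \<open>0\<close> to \<open>z\<close> in \<open>k\<close>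
  steps, with the last increment \<open>e\<close> split off. The link to an actual walk is made in
  \<open>emeasure_transition\<close>.\<close>

primrec heat :: "nat \<Rightarrow> int ^ 'd::finite \<Rightarrow> real" where
  "heat 0 z = of_bool (z = 0)"
| "heat (Suc k) z = (\<Sum>e | l1_norm e \<le> 1. heat k (z - e)) / (2 * real CARD('d) + 1)"

lemma heat_nonneg: "0 \<le> heat k z"
  by (induction k arbitrary: z) (auto intro!: divide_nonneg_nonneg sum_nonneg)

lemma pmf_srw_step:
  "pmf (srw_step x) z = of_bool (l1_norm (z - x) \<le> 1) / (2 * real CARD('d) + 1)"
  for x z :: "int ^ 'd::finite"
proof -
  have "bij_betw (\<lambda>e. x + e) {e. l1_norm e \<le> 1} {z. l1_norm (z - x) \<le> 1}"
    by (rule bij_betwI[where g = "\<lambda>z. z - x"]) auto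
  from bij_betw_same_card[OF this] have "card {z. l1_norm (z - x) \<le> 1} = 2 * CARD('d) + 1"
    by (simp add: card_l1_ball)
  then show ?thesis
    unfolding srw_step_def
    by (subst pmf_of_set[OF srw_step_nonempty finite_srw_step]) (simp add: indicator_def)
qed

lemma nn_integral_heat: "(\<integral>\<^sup>+z. ennreal (heat k z) \<partial>count_space UNIV) = 1"
proof (induction k)
  case 0
  have "(\<integral>\<^sup>+z. ennreal (heat 0 (z :: int ^ 'a)) \<partial>count_space UNIV) = (\<integral>\<^sup>+z. indicator {0 :: int ^ 'a} z \<partial>count_space UNIV)"
    by (intro nn_integral_cong) (auto split: split_indicator)
  then show ?case by simp
next
  case (Suc k)
  let ?c = "2 * real CARD('a) + 1"
  have shift: "(\<integral>\<^sup>+z. ennreal (heat k (z - e)) \<partial>count_space UNIV) = 1" for e :: "int ^ 'a"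
  proof -
    have "bij (\<lambda>z. z - e)" by (rule bij_betwI[where g = "\<lambda>z. z + e"]) auto
    from nn_integral_bij_count_space[OF this, of "\<lambda>z. ennreal (heat k z)"] show ?thesis
      using Suc by simp
  qed
  have "(\<integral>\<^sup>+z. ennreal (heat (Suc k) (z :: int ^ 'a)) \<partial>count_space UNIV)
      = (\<integral>\<^sup>+(z :: int ^ 'a). ennreal (1 / ?c) * (\<Sum>e | l1_norm e \<le> 1. ennreal (heat k (z - e))) \<partial>count_space UNIV)"
    by (simp add: sum_nonneg heat_nonneg ennreal_mult[symmetric] sum_ennreal field_simps)
  also have "\<dots> = ennreal (1 / ?c) * (\<Sum>e | l1_norm (e :: int ^ 'a) \<le> 1. \<integral>\<^sup>+z. ennreal (heat k (z - e)) \<partial>count_space UNIV)"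
    by (simp add: nn_integral_cmult nn_integral_sum)
  also have "\<dots> = ennreal (1 / ?c) * (\<Sum>e | l1_norm (e :: int ^ 'a) \<le> 1. 1)"
    by (simp only: shift)
  also have "(\<Sum>e | l1_norm (e :: int ^ 'a) \<le> 1. 1) = ennreal (real (2 * CARD('a) + 1))"
    by (simp only: sum_constant card_l1_ball ennreal_of_nat_eq_real_of_nat mult_1_right)
  also have "ennreal (1 / ?c) * \<dots> = ennreal (1 / ?c * real (2 * CARD('a) + 1))"
    by (intro ennreal_mult[symmetric]) auto
  also have "\<dots> = 1"
    by (simp add: add_nonneg_eq_0_iff)
  finally show ?case .
qed

text \<open>By the half-angle formula \<open>1 - cos x\<close> is twice the square of
  \<open>sin (x / 2)\<close>, so it suffices that \<open>sin y\<close> is at least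
  \<open>y / 2\<close> on \<open>[0, pi/2]\<close>. Below \<open>pi/3\<close> this is the mean value
  theorem with \<open>cos\<close> at least \<open>1/2\<close>; above, monotonicity of
  \<open>sin\<close>.\<close>

lemma one_minus_cos_ge:
  fixes x :: real
  assumes "\<bar>x\<bar> \<le> pi"
  shows "x\<^sup>2 / 8 \<le> 1 - cos x"
proof -
  define y where "y = \<bar>x\<bar> / 2"
  have y: "0 \<le> y" "y \<le> pi / 2" using assms by (auto simp: y_def)
  have "y / 2 \<le> sin y"
  proof (cases "y \<le> pi / 3")
    case True
    show ?thesis
    proof (cases "y = 0")
      case False
      then have "0 < y" using y by simp
      from MVT2[OF this, of sin cos] obtain \<xi> where \<xi>: "0 < \<xi>" "\<xi> < y" "sin y - sin 0 = (y - 0) * cos \<xi>"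
        by (auto intro: derivative_eq_intros)
      have "cos (pi / 3) \<le> cos \<xi>"
        using \<xi> True pi_gt_zero by (intro cos_monotone_0_pi_le) auto
      then have "1 / 2 \<le> cos \<xi>" by (simp add: cos_60)
      then have "y * (1 / 2) \<le> y * cos \<xi>"
        using y by (intro mult_left_mono) auto
      then show ?thesis using \<xi> by simp
    qed simp
  next
    case False
    \<comment> \<open>The number 1.6 separates \<open>pi / 2\<close> from \<open>sqrt 3\<close>,
      hence \<open>y / 2 \<le> pi / 4 \<le> sqrt 3 / 2\<close>.\<close>
    have "(1.6::real) \<le> sqrt 3"
      by (rule real_le_rsqrt) (simp add: power2_eq_square)
    then have "y / 2 \<le> sqrt 3 / 2"
      using y pi_approx by simp
    also have "\<dots> = sin (pi / 3)" by (simp add: sin_60)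
    also have "\<dots> \<le> sin y"
      using y False pi_gt_zero by (intro sin_monotone_2pi_le) auto
    finally show ?thesis .
  qed
  then have "(y / 2)\<^sup>2 \<le> (sin y)\<^sup>2"
    using y by (intro power_mono) auto
  moreover have "cos x = 1 - 2 * (sin y)\<^sup>2"
    by (subst cos_double_sin[symmetric]) (simp add: y_def)
  ultimately show ?thesis by (simp add: y_def power2_eq_square)
qed

section \<open>Fourier inversion on the torus\<close>

lemma emeasure_circle: "emeasure (restrict_space lborel {- pi..pi}) {- pi..pi} = ennreal (2 * pi)"
  by (subst emeasure_restrict_space) auto

lemma measure_circle: "measure (restrict_space lborel {- pi..pi}) {- pi..pi} = 2 * pi"
  by (simp add: measure_def emeasure_circle)

text \<open>Enlarge the domain to the whole line; there the integrand is
  \<open>sqrt (pi / a)\<close> times the centred normal density of variance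
  \<open>1 / (2 * a)\<close>, which has integral 1.\<close>

lemma integral_gaussian_le:
  fixes a :: real
  assumes "0 < a"
  shows "(LINT x|restrict_space lborel {- pi..pi}. exp (- a * x\<^sup>2)) \<le> sqrt (pi / a)"
proof -
  define \<sigma> where "\<sigma> = 1 / sqrt (2 * a)"
  have \<sigma>: "0 < \<sigma>" "\<sigma>\<^sup>2 = 1 / (2 * a)" using assms by (auto simp: \<sigma>_def power_divide)
  have eq: "exp (- a * x\<^sup>2) = sqrt (pi / a) * normal_density 0 \<sigma> x" for x
    using assms by (simp add: normal_density_def \<sigma>(2) real_sqrt_divide)
  have int: "integrable lborel (\<lambda>x. exp (- a * x\<^sup>2))"
    unfolding eq using \<sigma> by simp
  have "(LINT x|restrict_space lborel {- pi..pi}. exp (- a * x\<^sup>2)) = (LINT x|lborel. indicator {- pi..pi} x * exp (- a * x\<^sup>2))"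
    by (subst integral_restrict_space) auto
  also have "\<dots> \<le> (LINT x|lborel. exp (- a * x\<^sup>2))"
    using integrable_mult_indicator[OF _ int, of "{- pi..pi}"] int
    by (intro integral_mono) (auto split: split_indicator)
  also have "\<dots> = sqrt (pi / a)"
    unfolding eq using \<sigma> by simp
  finally show ?thesis .
qed

text \<open>Orthogonality of characters: for \<open>m \<noteq> 0\<close> the antiderivative takes
  the same value at both ends of the period.\<close>

lemma integral_cis:
  "(LINT x|restrict_space lborel {- pi..pi}. cis (x * of_int m)) = (if m = 0 then 2 * pi else 0)"
proof (cases "m = 0")
  case True
  then show ?thesis
    by (subst integral_restrict_space) (auto simp: scaleR_conv_of_real)
next
  case False
  let ?F = "\<lambda>x. cis (x * of_int m) / (\<i> * of_int m)"
  have eq: "?F pi = ?F (- pi)"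
    by (auto simp: complex_eq_iff Re_divide Im_divide)
  have "(LBINT x. indicator {- pi..pi} x *\<^sub>R cis (x * of_int m)) = ?F pi - ?F (- pi)"
    by (rule integral_FTC_Icc)
      (use False in \<open>auto intro!: derivative_eq_intros continuous_intros
        simp: has_vector_derivative_def scaleR_conv_of_real field_simps\<close>)
  then show ?thesis
    using False unfolding eq by (subst integral_restrict_space) auto
qed

text \<open>The angles form a function rather than a vector, so that they are points of the product
  measure \<open>torus\<close>.\<close>

definition dot :: "('d \<Rightarrow> real) \<Rightarrow> int ^ 'd::finite \<Rightarrow> real" where
  "dot \<theta> z = (\<Sum>i\<in>UNIV. \<theta> i * of_int (z $ i))"

lemma dot_diff: "dot \<theta> (z - e) = dot \<theta> z - dot \<theta> e"
  by (simp add: dot_def algebra_simps sum_subtractf)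

lemma dot_axis: "dot \<theta> (axis i a) = \<theta> i * of_int a"
  by (simp add: dot_def axis_def if_distrib[of of_int] if_distrib[of "(*) _"] cong: if_cong)

text \<open>The characteristic function of one increment. It is real because the increments are
  symmetric, and the summand \<open>1\<close> comes from the increment \<open>0\<close>.\<close>

definition char_step :: "('d::finite \<Rightarrow> real) \<Rightarrow> real" where
  "char_step \<theta> = (1 + 2 * (\<Sum>i\<in>UNIV. cos (\<theta> i))) / (2 * real CARD('d) + 1)"

lemma cis_uminus: "cis (- x) + cis x = of_real (2 * cos x)"
  by (simp add: complex_eq_iff)

lemma sum_cis_l1_ball:
  "(\<Sum>e | l1_norm e \<le> 1. cis (dot \<theta> (z - e))) =
   cis (dot \<theta> z) * of_real ((2 * real CARD('d) + 1) * char_step \<theta>)"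
  for \<theta> :: "'d::finite \<Rightarrow> real"
proof -
  have "(\<Sum>e | l1_norm e \<le> 1. cis (dot \<theta> (z - e)))
      = cis (dot \<theta> z) * (\<Sum>e | l1_norm e \<le> 1. cis (- dot \<theta> e))"
    by (simp add: dot_diff cis_mult sum_distrib_left)
  also have "(\<Sum>e | l1_norm e \<le> 1. cis (- dot \<theta> e)) = 1 + (\<Sum>i\<in>UNIV. cis (- \<theta> i) + cis (\<theta> i))"
    by (subst sum_l1_ball) (simp add: dot_axis dot_def[of _ 0])
  also have "\<dots> = of_real ((2 * real CARD('d) + 1) * char_step \<theta>)"
    by (simp add: cis_uminus char_step_def sum_distrib_left add_nonneg_eq_0_iff)
  finally show ?thesis .
qed

lemma abs_char_step_le_1: "\<bar>char_step \<theta>\<bar> \<le> 1"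
proof -
  have "\<bar>\<Sum>i\<in>UNIV. cos (\<theta> i)\<bar> \<le> (\<Sum>i\<in>(UNIV::'a set). 1)"
    by (intro order_trans[OF sum_abs] sum_mono) simp
  then show ?thesis by (simp add: char_step_def abs_le_iff field_simps)
qed

text \<open>The measure is not normalised; its total mass is the factor
  \<open>(2 * pi) ^ CARD('d)\<close> in \<open>heat_fourier\<close>.\<close>

abbreviation torus :: "('d::finite \<Rightarrow> real) measure" where
  "torus \<equiv> PiM UNIV (\<lambda>_. restrict_space lborel {- pi..pi})"

interpretation circle: finite_measure "restrict_space lborel {- pi..pi}"
  by (rule finite_measureI) (simp add: emeasure_restrict_space space_restrict_space)

interpretation circles: product_sigma_finite "\<lambda>_. restrict_space lborel {- pi..pi}"
  by unfold_locales

interpretation torus: finite_measure "torus :: ('d::finite \<Rightarrow> real) measure"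
proof (rule finite_measureI)
  have "emeasure (torus :: ('d \<Rightarrow> real) measure) (PiE UNIV (\<lambda>_. space (restrict_space lborel {- pi..pi})))
      = (\<Prod>i\<in>(UNIV::'d set). emeasure (restrict_space lborel {- pi..pi}) (space (restrict_space lborel {- pi..pi})))"
    by (rule circles.emeasure_PiM) (rule finite, rule sets.top)
  then show "emeasure torus (space (torus :: ('d \<Rightarrow> real) measure)) \<noteq> \<infinity>"
    by (simp add: space_PiM space_restrict_space emeasure_circle ennreal_power del: ennreal_mult_top)
qed

lemma measurable_torus_component [measurable]:
  "(\<lambda>\<theta>. \<theta> i) \<in> borel_measurable (torus :: ('d::finite \<Rightarrow> real) measure)"
proof -
  have "(\<lambda>\<theta>. \<theta> i) \<in> torus \<rightarrow>\<^sub>M restrict_space lborel {- pi..pi}"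
    by measurable
  then show ?thesis
    by (simp add: measurable_restrict_space2_iff)
qed

lemma measurable_dot [measurable]: "(\<lambda>\<theta>. dot \<theta> z) \<in> borel_measurable torus"
  unfolding dot_def by measurable

lemma measurable_char_step [measurable]: "char_step \<in> borel_measurable torus"
  unfolding char_step_def by measurable

lemma measurable_cis [measurable]: "cis \<in> borel_measurable borel"
  by (intro borel_measurable_continuous_onI continuous_intros)

lemma integrable_char_step_cis:
  "integrable torus (\<lambda>\<theta>. of_real (char_step \<theta>) ^ k * cis (dot \<theta> z))"
  by (rule torus.integrable_const_bound[where B = 1])
    (auto simp: norm_mult norm_power power_le_one abs_char_step_le_1)

text \<open>Induction on \<open>k\<close>: the base case is orthogonality of characters in each
  coordinate, and averaging a character over the increments multiplies it by
  \<open>char_step\<close>.\<close>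

lemma heat_fourier:
  "of_real (heat k z) * of_real (2 * pi) ^ CARD('d) =
   (LINT \<theta>|torus. of_real (char_step \<theta>) ^ k * cis (dot \<theta> z))"
  for z :: "int ^ 'd::finite"
proof (induction k arbitrary: z)
  case 0
  have cis_sum: "cis (\<Sum>i\<in>A. f i) = (\<Prod>i\<in>A. cis (f i))" if "finite A" for A :: "'d set" and f
    using that by induction (auto simp: cis_mult[symmetric])
  have bd: "integrable (restrict_space lborel {- pi..pi}) (\<lambda>x. cis (x * of_int m))" for m
    by (rule circle.integrable_const_bound[where B = 1]) (auto intro!: measurable_restrict_space1)
  have "(LINT \<theta>|torus. cis (dot \<theta> z)) = (LINT \<theta>|torus. (\<Prod>i\<in>UNIV. cis (\<theta> i * of_int (z $ i))))"
    by (simp add: dot_def cis_sum)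
  also have "\<dots> = (\<Prod>i\<in>UNIV. LINT x|restrict_space lborel {- pi..pi}. cis (x * of_int (z $ i)))"
    by (rule circles.product_integral_prod) (simp_all add: bd)
  also have "\<dots> = of_bool (z = 0) * of_real (2 * pi) ^ CARD('d)"
  proof (cases "z = 0")
    case False
    then obtain i where "z $ i \<noteq> 0" by (auto simp: vec_eq_iff)
    then show ?thesis using False by (auto simp: integral_cis intro!: prod_zero)
  qed (simp add: measure_circle space_restrict_space scaleR_conv_of_real)
  finally show ?case by simp
next
  case (Suc k)
  let ?c = "2 * real CARD('d) + 1"
  have c: "complex_of_real ?c \<noteq> 0"
    by (subst of_real_eq_0_iff) simp
  have "of_real ?c * (of_real (heat (Suc k) z) * of_real (2 * pi) ^ CARD('d))
      = (\<Sum>e | l1_norm e \<le> 1. of_real (heat k (z - e)) * of_real (2 * pi) ^ CARD('d) :: complex)"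
    using c by (simp add: sum_distrib_right)
  also have "\<dots> = (\<Sum>e | l1_norm e \<le> 1. LINT \<theta>|torus. of_real (char_step \<theta>) ^ k * cis (dot \<theta> (z - e)))"
    by (simp only: Suc)
  also have "\<dots> = (LINT \<theta>|torus. of_real (char_step \<theta>) ^ k * (\<Sum>e | l1_norm e \<le> 1. cis (dot \<theta> (z - e))))"
    by (simp add: sum_distrib_left integrable_char_step_cis Bochner_Integration.integral_sum)
  also have "\<dots> = (LINT \<theta>|torus. of_real ?c * (of_real (char_step \<theta>) ^ Suc k * cis (dot \<theta> z)))"
    by (simp add: sum_cis_l1_ball mult_ac)
  also have "\<dots> = of_real ?c * (LINT \<theta>|torus. of_real (char_step \<theta>) ^ Suc k * cis (dot \<theta> z))"
    by (rule integral_mult_right_zero)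
  finally show ?case using c by (simp only: mult_cancel_left) simp
qed

text \<open>Aperiodicity enters here: the increment \<open>0\<close> keeps \<open>char_step\<close>
  away from \<open>-1\<close>, so its absolute value is close to 1 only near the origin, where
  \<open>one_minus_cos_ge\<close> gives Gaussian decay.\<close>

lemma abs_char_step_le:
  fixes \<theta> :: "'d::finite \<Rightarrow> real"
  assumes "\<And>i. \<bar>\<theta> i\<bar> \<le> pi"
  defines "\<gamma> \<equiv> 1 / (8 * real CARD('d) * (2 * real CARD('d) + 1))"
  shows "\<bar>char_step \<theta>\<bar> \<le> (\<Prod>i\<in>UNIV. exp (- \<gamma> * (\<theta> i)\<^sup>2))"
proof -
  define d where "d = real CARD('d)"
  define s where "s = (\<Sum>i\<in>UNIV. 1 - cos (\<theta> i))"
  have d: "1 \<le> d" by (simp add: d_def Suc_le_eq)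
  have s: "0 \<le> s" "s \<le> 2 * d"
  proof -
    have "s \<le> (\<Sum>i\<in>(UNIV::'d set). 2)" unfolding s_def
      by (intro sum_mono) (use cos_ge_minus_one in \<open>smt (verit)\<close>)
    then show "s \<le> 2 * d" by (simp add: d_def)
  qed (auto simp: s_def intro!: sum_nonneg)
  have eq: "char_step \<theta> = 1 - 2 * s / (2 * d + 1)"
    using d by (simp add: char_step_def s_def d_def sum_subtractf field_simps)
  \<comment> \<open>With \<open>char_step \<theta> = 1 - 2 * s / (2 * d + 1)\<close>, the target is
    \<open>1 - s / (d * (2 * d + 1))\<close>. The factor \<open>d\<close> is dictated by the extreme
    case \<open>s = 2 * d\<close>, where \<open>char_step \<theta>\<close> equals
    \<open>-1 + 2 / (2 * d + 1)\<close> and the bound is attained in absolute value.\<close>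
  have "s / (d * (2 * d + 1)) \<le> s / (2 * d + 1)"
    using s d by (intro divide_left_mono) auto
  moreover have "s / (d * (2 * d + 1)) \<le> 2 * d / (d * (2 * d + 1))"
    using s d by (intro divide_right_mono) auto
  moreover have "s / (2 * d + 1) \<le> 2 * d / (2 * d + 1)"
    using s d by (intro divide_right_mono) auto
  moreover have "s / (2 * d + 1) \<le> 2 * s / (2 * d + 1)"
    using s d by (intro divide_right_mono) auto
  moreover have "2 * d / (d * (2 * d + 1)) + 2 * (2 * d / (2 * d + 1)) = 2"
    using d by (simp add: divide_simps) (simp add: algebra_simps)
  ultimately have "\<bar>char_step \<theta>\<bar> \<le> 1 - s / (d * (2 * d + 1))"
    using s d unfolding eq by (auto simp: abs_le_iff)
  also have "\<dots> \<le> exp (- (s / (d * (2 * d + 1))))"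
    using exp_ge_add_one_self[of "- (s / (d * (2 * d + 1)))"] by simp
  also have "\<dots> \<le> exp (\<Sum>i\<in>UNIV. - \<gamma> * (\<theta> i)\<^sup>2)"
  proof -
    have "(\<Sum>i\<in>UNIV. (\<theta> i)\<^sup>2 / 8) \<le> s"
      unfolding s_def by (intro sum_mono one_minus_cos_ge assms)
    then have "(\<Sum>i\<in>UNIV. (\<theta> i)\<^sup>2 / 8) / (d * (2 * d + 1)) \<le> s / (d * (2 * d + 1))"
      using d by (intro divide_right_mono) auto
    moreover have "(\<Sum>i\<in>UNIV. (\<theta> i)\<^sup>2 / 8) / (d * (2 * d + 1)) = (\<Sum>i\<in>UNIV. \<gamma> * (\<theta> i)\<^sup>2)"
      by (simp add: sum_divide_distrib \<gamma>_def d_def mult_ac)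
    ultimately show ?thesis by (simp add: sum_negf)
  qed
  finally show ?thesis by (simp add: exp_sum)
qed

text \<open>Take absolute values inside the Fourier integral. The Gaussian bound on
  \<open>char_step\<close> factorises over the coordinates, and each factor contributes
  \<open>k\<close> to the power \<open>-1/2\<close>.\<close>

lemma heat_le_powr:
  fixes z :: "int ^ 'd::finite"
  defines "\<gamma> \<equiv> 1 / (8 * real CARD('d) * (2 * real CARD('d) + 1))"
  assumes k: "0 < k"
  shows "heat k z \<le> (pi / (\<gamma> * real k)) powr (real CARD('d) / 2)"
proof -
  have \<gamma>: "0 < \<gamma>" by (simp add: \<gamma>_def Suc_le_eq)
  have intg: "integrable (restrict_space lborel {- pi..pi}) (\<lambda>x. exp (- (\<gamma> * real k) * x\<^sup>2))"
    using \<gamma> by (intro circle.integrable_const_bound[where B = 1]) (auto intro!: measurable_restrict_space1 AE_I2)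
  have "heat k z \<le> heat k z * (2 * pi) ^ CARD('d)"
  proof -
    have "1 \<le> (2 * pi) ^ CARD('d)" using pi_gt3 by (intro one_le_power) simp
    from mult_left_mono[OF this heat_nonneg[of k z]] show ?thesis by simp
  qed
  also have "\<dots> = norm (complex_of_real (heat k z) * of_real (2 * pi) ^ CARD('d))"
    by (simp add: norm_mult norm_power heat_nonneg)
  also have "\<dots> \<le> (LINT \<theta>|torus. norm (complex_of_real (char_step (\<theta> :: 'd \<Rightarrow> real)) ^ k * cis (dot \<theta> z)))"
    unfolding heat_fourier by (rule integral_norm_bound)
  also have "\<dots> = (LINT \<theta>|torus. \<bar>char_step (\<theta> :: 'd \<Rightarrow> real)\<bar> ^ k)"
    by (simp add: norm_mult norm_power)
  also have "\<dots> \<le> (LINT \<theta>|torus. (\<Prod>i\<in>(UNIV :: 'd set). exp (- (\<gamma> * real k) * (\<theta> i)\<^sup>2)))"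
  proof (rule integral_mono)
    show "integrable torus (\<lambda>\<theta> :: 'd \<Rightarrow> real. \<bar>char_step \<theta>\<bar> ^ k)"
      by (rule torus.integrable_const_bound[where B = 1]) (auto simp: power_le_one abs_char_step_le_1)
    show "integrable torus (\<lambda>\<theta>. \<Prod>i\<in>(UNIV :: 'd set). exp (- (\<gamma> * real k) * (\<theta> i)\<^sup>2))"
      using intg by (intro circles.product_integrable_prod) auto
    fix \<theta> :: "'d \<Rightarrow> real" assume "\<theta> \<in> space torus"
    then have "- pi \<le> \<theta> i \<and> \<theta> i \<le> pi" for i
      by (auto simp: space_PiM space_restrict_space PiE_def Pi_def)
    then have "\<bar>\<theta> i\<bar> \<le> pi" for i by (smt (verit))
    from abs_char_step_le[OF this] have "\<bar>char_step \<theta>\<bar> ^ k \<le> (\<Prod>i\<in>UNIV. exp (- \<gamma> * (\<theta> i)\<^sup>2)) ^ k"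
      unfolding \<gamma>_def by (intro power_mono) auto
    also have "\<dots> = (\<Prod>i\<in>UNIV. exp (- (\<gamma> * real k) * (\<theta> i)\<^sup>2))"
      by (simp add: prod_power_distrib mult_ac flip: exp_of_nat_mult)
    finally show "\<bar>char_step \<theta>\<bar> ^ k \<le> (\<Prod>i\<in>UNIV. exp (- (\<gamma> * real k) * (\<theta> i)\<^sup>2))" .
  qed
  also have "\<dots> = (\<Prod>i\<in>(UNIV :: 'd set). LINT x|restrict_space lborel {- pi..pi}. exp (- (\<gamma> * real k) * x\<^sup>2))"
    using intg by (intro circles.product_integral_prod) auto
  also have "\<dots> \<le> (\<Prod>i\<in>(UNIV :: 'd set). sqrt (pi / (\<gamma> * real k)))"
    using \<gamma> k by (intro prod_mono conjI integral_gaussian_le integral_nonneg) auto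
  also have "\<dots> = (pi / (\<gamma> * real k)) powr (real CARD('d) / 2)"
    using \<gamma> k by (simp add: powr_half_sqrt[symmetric] powr_powr flip: powr_realpow)
  finally show ?thesis .
qed

lemma heat_decay:
  "\<exists>C\<ge>1. \<forall>k (z :: int ^ 'd::finite). heat k z \<le> C * (real k + 1) powr (- real CARD('d) / 2)"
proof -
  define d where "d = real CARD('d)"
  define \<gamma> where "\<gamma> = 1 / (8 * d * (2 * d + 1))"
  have \<gamma>: "0 < \<gamma>" by (simp add: \<gamma>_def d_def Suc_le_eq)
  \<comment> \<open>The summand \<open>1\<close> covers \<open>k = 0\<close>; the factor
    \<open>2\<close> pays for replacing \<open>1 / k\<close> by \<open>1 / (k + 1)\<close>.\<close>
  define C where "C = 1 + (2 * pi / \<gamma>) powr (d / 2)"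
  have "heat k z \<le> C * (real k + 1) powr (- d / 2)" for k and z :: "int ^ 'd"
  proof (cases "k = 0")
    case True
    then show ?thesis by (simp add: C_def)
  next
    case False
    have "heat k z \<le> (pi / (\<gamma> * real k)) powr (d / 2)"
      using heat_le_powr[of k z] False by (simp add: \<gamma>_def d_def)
    also have "\<dots> \<le> (2 * pi / \<gamma> / (real k + 1)) powr (d / 2)"
    proof (intro powr_mono2)
      have "pi / \<gamma> * (1 / real k) \<le> pi / \<gamma> * (2 / (real k + 1))"
        using False \<gamma> by (intro mult_left_mono) (auto simp: field_simps)
      then show "pi / (\<gamma> * real k) \<le> 2 * pi / \<gamma> / (real k + 1)" by (simp add: mult_ac)
    qed (use \<gamma> in \<open>auto simp: d_def\<close>)
    also have "\<dots> = (2 * pi / \<gamma>) powr (d / 2) * (real k + 1) powr (- d / 2)"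
      using \<gamma> by (subst powr_divide) (auto simp: powr_minus_divide)
    also have "\<dots> \<le> C * (real k + 1) powr (- d / 2)"
      by (intro mult_right_mono) (auto simp: C_def)
    finally show ?thesis .
  qed
  then show ?thesis
    unfolding d_def by (intro exI[of _ C]) (auto simp: C_def)
qed

subsection \<open>Summability of powers of the Green function\<close>

lemma nn_integral_powr_nat_less_top:
  assumes "s < - 1"
  shows "(\<integral>\<^sup>+k. ennreal ((real k + 1) powr s) \<partial>count_space UNIV) < \<top>"
proof -
  have "summable (\<lambda>k. of_nat (Suc k) powr s)"
    using assms by (subst summable_Suc_iff) (simp add: summable_real_powr_iff)
  then have "summable (\<lambda>k. (real k + 1) powr s)" by (simp add: add_ac)
  then show ?thesis
    by (simp add: nn_integral_count_space_nat suminf_ennreal2 less_top)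
qed

definition green :: "int ^ 'd::finite \<Rightarrow> ennreal" where
  "green z = (\<integral>\<^sup>+k. ennreal (heat k z) \<partial>count_space UNIV)"

text \<open>Jensen's inequality moves the power \<open>q\<close> inside the sum over
  \<open>k\<close>. Of the power \<open>q\<close> of \<open>heat k z\<close>, one factor sums to 1
  over the sites, while the remaining power \<open>q - 1\<close> is bounded uniformly by
  \<open>heat_decay\<close>; what is left is a series of powers of \<open>k + 1\<close>.\<close>

lemma nn_integral_green_powr_less_top:
  fixes q :: real
  assumes d: "3 \<le> CARD('d::finite)" and q: "real CARD('d) / (real CARD('d) - 2) < q"
  shows "(\<integral>\<^sup>+z. ennpowr (green (z :: int ^ 'd)) q \<partial>count_space UNIV) < \<top>"
proof -
  define d where "d = real CARD('d)"
  have d3: "3 \<le> d" using d by (simp add: d_def)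
  obtain C where C: "1 \<le> C" "\<And>k (z :: int ^ 'd). heat k z \<le> C * (real k + 1) powr (- d / 2)"
    using heat_decay[where 'd = 'd] by (auto simp: d_def)
  have q2: "2 / (d - 2) < q - 1"
    using q d3 by (simp add: d_def[symmetric] field_simps)
  have "0 < 2 / (d - 2)" using d3 by simp
  then have q1: "0 < q - 1" using q2 by linarith
  \<comment> \<open>The sum over \<open>k\<close> of \<open>heat k z\<close> is written as an integral against the finite measure with weights
    \<open>(k + 1)\<^bsup>-s\<^esup>\<close>; any \<open>s\<close> strictly between \<open>1\<close> and \<open>d/2 - 1/(q - 1)\<close> makes both this measure finite
    and the sum produced by Jensen's inequality convergent.\<close>
  define s where "s = (1 + d / 2 - 1 / (q - 1)) / 2"
  have gap: "1 / (q - 1) < d / 2 - 1"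
    using q2 q1 d3 by (simp add: field_simps)
  have s: "1 < s" "s < d / 2 - 1 / (q - 1)"
    using gap by (auto simp: s_def)
  \<comment> \<open>The decay contributes \<open>d / 2 * (q - 1)\<close> to this exponent, and the
    weights take away \<open>s * (q - 1)\<close>; the upper bound on \<open>s\<close> says exactly
    that the difference exceeds 1.\<close>
  define \<beta> where "\<beta> = (d / 2 - s) * (q - 1)"
  have \<beta>: "1 < \<beta>"
    using s q1 by (simp add: \<beta>_def field_simps)
  define w where "w k = (real k + 1) powr (- s)" for k :: nat
  have w: "0 < w k" for k by (simp add: w_def)
  let ?\<mu> = "density (count_space UNIV) (\<lambda>k. ennreal (w k))"
  have em: "emeasure ?\<mu> (space ?\<mu>) = (\<integral>\<^sup>+k. ennreal (w k) \<partial>count_space UNIV)"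
    by (subst emeasure_density) auto
  also have "\<dots> < \<top>"
    unfolding w_def using s by (intro nn_integral_powr_nat_less_top) simp
  finally obtain m where m: "emeasure ?\<mu> (space ?\<mu>) = ennreal m" "0 \<le> m"
    by (cases "emeasure ?\<mu> (space ?\<mu>)") auto
  have "ennreal (w 0) \<le> ennreal m"
    unfolding m(1)[symmetric] em by (rule nn_integral_ge_point) simp
  then have m0: "0 < m"
    using w[of 0] m by (simp add: ennreal_le_iff)
  have main: "ennpowr (green z) q \<le>
      ennreal (m powr (q - 1)) * (\<integral>\<^sup>+k. ennreal (C powr (q - 1) * (real k + 1) powr (- \<beta>)) * ennreal (heat k z) \<partial>count_space UNIV)"
    for z :: "int ^ 'd"
  proof -
    have "green z = (\<integral>\<^sup>+k. ennreal (heat k z / w k) \<partial>?\<mu>)"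
      using w by (subst nn_integral_density)
        (auto simp: green_def ennreal_mult[symmetric] heat_nonneg less_imp_le less_imp_neq[symmetric] intro!: nn_integral_cong)
    then have "ennpowr (green z) q \<le> ennreal (m powr (q - 1)) * (\<integral>\<^sup>+k. ennpowr (ennreal (heat k z / w k)) q \<partial>?\<mu>)"
      using jensen_ennpowr[OF _ m(1) m0, of "\<lambda>k. ennreal (heat k z / w k)" q] q1 by simp
    also have "(\<integral>\<^sup>+k. ennpowr (ennreal (heat k z / w k)) q \<partial>?\<mu>)
        = (\<integral>\<^sup>+k. ennreal (w k * (heat k z / w k) powr q) \<partial>count_space UNIV)"
      using w by (subst nn_integral_density)
        (auto simp: ennpowr_ennreal ennreal_mult heat_nonneg less_imp_le intro!: nn_integral_cong)
    also have "\<dots> \<le> (\<integral>\<^sup>+k. ennreal (C powr (q - 1) * (real k + 1) powr (- \<beta>)) * ennreal (heat k z) \<partial>count_space UNIV)"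
    proof (rule nn_integral_mono)
      fix k
      let ?h = "heat k z"
      have "w k * (?h / w k) powr q = w k powr (1 - q) * (?h powr (q - 1) * ?h)"
      proof (cases "?h = 0")
        case False
        then have "0 < ?h" using heat_nonneg[of k z] by simp
        then show ?thesis
          using w[of k] by (simp add: powr_divide powr_diff)
      qed simp
      also have "\<dots> \<le> w k powr (1 - q) * ((C * (real k + 1) powr (- d / 2)) powr (q - 1) * ?h)"
        using q1 C by (intro mult_left_mono mult_right_mono powr_mono2) (auto simp: heat_nonneg)
      also have "\<dots> = C powr (q - 1) * (real k + 1) powr (- \<beta>) * ?h"
      proof -
        have "w k powr (1 - q) * ((real k + 1) powr (- d / 2)) powr (q - 1) = (real k + 1) powr (- \<beta>)"
          by (simp add: w_def powr_powr \<beta>_def algebra_simps flip: powr_add)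
        then show ?thesis
          using C by (simp add: powr_mult mult_ac)
      qed
      finally show "ennreal (w k * (?h / w k) powr q) \<le> ennreal (C powr (q - 1) * (real k + 1) powr (- \<beta>)) * ennreal ?h"
        using heat_nonneg[of k z] by (simp add: ennreal_mult[symmetric] ennreal_leI)
    qed
    finally show ?thesis by (simp add: mult_left_mono)
  qed
  have "(\<integral>\<^sup>+z. ennpowr (green (z :: int ^ 'd)) q \<partial>count_space UNIV) \<le>
      (\<integral>\<^sup>+(z :: int ^ 'd). ennreal (m powr (q - 1)) * (\<integral>\<^sup>+k. ennreal (C powr (q - 1) * (real k + 1) powr (- \<beta>)) * ennreal (heat k z) \<partial>count_space UNIV) \<partial>count_space UNIV)"
    by (intro nn_integral_mono main)
  also have "\<dots> = ennreal (m powr (q - 1)) * (\<integral>\<^sup>+k. (\<integral>\<^sup>+(z :: int ^ 'd). ennreal (C powr (q - 1) * (real k + 1) powr (- \<beta>)) * ennreal (heat k z) \<partial>count_space UNIV) \<partial>count_space UNIV)"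
    by (subst nn_integral_cmult, simp, subst nn_integral_count_space_nn_integral) auto
  also have "\<dots> = ennreal (m powr (q - 1)) * (ennreal (C powr (q - 1)) * (\<integral>\<^sup>+k. ennreal ((real k + 1) powr (- \<beta>)) \<partial>count_space UNIV))"
    by (simp add: nn_integral_cmult nn_integral_heat ennreal_mult)
  also have "\<dots> < \<top>"
    using nn_integral_powr_nat_less_top[of "- \<beta>"] \<beta> by (auto intro!: ennreal_mult_less_top[THEN iffD2] simp: ennreal_mult_less_top)
  finally show ?thesis .
qed

subsection \<open>The Markov property and ordered visits\<close>

lemma bij_betw_permute_list:
  assumes "p permutes {..<n}"
  shows "bij_betw (permute_list p) {xs. length xs = n} {xs. length xs = n}"
  using assms by (intro bij_betwI[where g = "permute_list (inv p)"])
    (auto simp: permute_list_compose[symmetric] permutes_inv permutes_inv_o)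

lemma nn_integral_heat_step:
  fixes x y :: "int ^ 'd::finite"
  shows "(\<integral>\<^sup>+w. ennreal (heat r (w - x)) * ennreal (pmf (srw_step w) y) \<partial>count_space UNIV) =
    ennreal (heat (Suc r) (y - x))"
proof -
  let ?c = "2 * real CARD('d) + 1"
  have bij: "bij (\<lambda>e. y - e)" by (rule bij_betwI[where g = "\<lambda>w. y - w"]) auto
  have "(\<integral>\<^sup>+w. ennreal (heat r (w - x)) * ennreal (pmf (srw_step w) y) \<partial>count_space UNIV)
     = (\<integral>\<^sup>+e. ennreal (heat r (y - e - x)) * ennreal (pmf (srw_step (y - e)) y) \<partial>count_space UNIV)"
    by (rule nn_integral_bij_count_space[OF bij, symmetric])
  also have "\<dots> = (\<integral>\<^sup>+e. ennreal (heat r (y - x - e) / ?c) * indicator {e. l1_norm e \<le> 1} e \<partial>count_space UNIV)"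
    by (intro nn_integral_cong)
      (auto simp: pmf_srw_step ennreal_mult[symmetric] heat_nonneg algebra_simps split: split_indicator)
  also have "\<dots> = (\<Sum>e | l1_norm e \<le> 1. ennreal (heat r (y - x - e) / ?c))"
    by (simp add: nn_integral_count_space_indicator[symmetric] nn_integral_count_space_finite finite_l1_ball)
  also have "\<dots> = ennreal (heat (Suc r) (y - x))"
    by (simp add: heat_nonneg sum_ennreal sum_divide_distrib)
  finally show ?thesis .
qed

text \<open>For a walk standing at \<open>x\<close>, this is the expected number of nondecreasing
  lists of times at which the given sites are visited in order; see
  \<open>emeasure_visits_sorted\<close>.\<close>

primrec chain :: "int ^ 'd::finite \<Rightarrow> (int ^ 'd) list \<Rightarrow> ennreal" where
  "chain x [] = 1"
| "chain x (z # zs) = green (z - x) * chain z zs"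

text \<open>By translation invariance the sum over the next site does not depend on the current one,
  so the sites can be summed out one by one.\<close>

lemma nn_integral_chain_powr:
  fixes x :: "int ^ 'd::finite"
  shows "(\<integral>\<^sup>+zs. ennpowr (chain x zs) q \<partial>count_space {zs. length zs = n}) =
   (\<integral>\<^sup>+z. ennpowr (green (z :: int ^ 'd)) q \<partial>count_space UNIV) ^ n"
proof (induction n arbitrary: x)
  case (Suc n)
  have bij: "bij (\<lambda>z. z - x)" by (rule bij_betwI[where g = "\<lambda>w. w + x"]) auto
  have "(\<integral>\<^sup>+z. ennpowr (green (z - x)) q \<partial>count_space UNIV) = (\<integral>\<^sup>+z. ennpowr (green (z :: int ^ 'd)) q \<partial>count_space UNIV)"
    using nn_integral_bij_count_space[OF bij, where f = "\<lambda>z. ennpowr (green z) q"] .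
  then show ?case
    by (simp add: nn_integral_count_space_Suc_length ennpowr_mult nn_integral_cmult nn_integral_multc Suc)
qed (simp add: nn_integral_count_space_length_0[simplified])

section \<open>The Markov property for events of the past\<close>

locale srw_walk = prob_space M for M :: "'a measure" +
  fixes S :: "nat \<Rightarrow> 'a \<Rightarrow> int ^ 'd::finite"
  assumes srw: "aperiodic_srw M S"
begin

lemma measurable_S [measurable]: "S n \<in> M \<rightarrow>\<^sub>M count_space UNIV"
  using srw by (simp add: aperiodic_srw_def)

lemma emeasure_start: "emeasure M {\<omega> \<in> space M. S 0 \<omega> = 0} = 1"
proof -
  have "AE \<omega> in M. S 0 \<omega> = 0" using srw by (simp add: aperiodic_srw_def)
  then show ?thesis
    by (subst emeasure_eq_1_AE) auto
qed

text \<open>Being determined by the path up to time \<open>k\<close> is expressed for predicates,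
  because \<open>aperiodic_srw\<close> speaks of single finite paths and such a predicate splits
  into countably many of them.\<close>

definition past :: "nat \<Rightarrow> ('a \<Rightarrow> bool) \<Rightarrow> bool" where
  "past k D \<longleftrightarrow> (\<forall>\<omega> \<omega>'. (\<forall>i\<le>k. S i \<omega> = S i \<omega>') \<longrightarrow> D \<omega> = D \<omega>')"

lemma past_mono: "past k D \<Longrightarrow> k \<le> l \<Longrightarrow> past l D"
  unfolding past_def by (meson order_trans)

lemma past_conj: "past k D \<Longrightarrow> past k E \<Longrightarrow> past k (\<lambda>\<omega>. D \<omega> \<and> E \<omega>)"
  unfolding past_def by metis

lemma past_at: "j \<le> k \<Longrightarrow> past k (\<lambda>\<omega>. S j \<omega> = x)"
  unfolding past_def by auto

definition cylinder :: "nat \<Rightarrow> (int ^ 'd) list \<Rightarrow> 'a set" where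
  "cylinder k l = {\<omega> \<in> space M. \<forall>i\<le>k. S i \<omega> = l ! i}"

lemma cylinder_sets [measurable]: "cylinder k l \<in> sets M"
  unfolding cylinder_def by measurable

text \<open>Fixing the length at \<open>Suc k\<close> (times \<open>0\<close> to \<open>k\<close>)
  makes the cylinders of different lists disjoint; requiring a witness in \<open>D\<close> makes
  their union exactly the event.\<close>

definition prefixes :: "nat \<Rightarrow> ('a \<Rightarrow> bool) \<Rightarrow> (int ^ 'd) list set" where
  "prefixes k D = {l. length l = Suc k \<and> (\<exists>\<omega>\<in>space M. D \<omega> \<and> (\<forall>i\<le>k. S i \<omega> = l ! i))}"

lemma disjoint_cylinders: "disjoint_family_on (\<lambda>l. cylinder k l \<inter> A) (prefixes k D)"
  by (auto simp: disjoint_family_on_def cylinder_def prefixes_def intro: nth_equalityI)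

lemma past_eq_UN:
  assumes "past k D"
  shows "{\<omega> \<in> space M. D \<omega>} = (\<Union>l\<in>prefixes k D. cylinder k l)"
proof (intro subset_antisym subsetI)
  fix \<omega> assume \<omega>: "\<omega> \<in> {\<omega> \<in> space M. D \<omega>}"
  let ?l = "map (\<lambda>i. S i \<omega>) [0..<Suc k]"
  have "S i \<omega> = ?l ! i" if "i \<le> k" for i
    using that by (simp del: upt_Suc)
  then have "?l \<in> prefixes k D" "\<omega> \<in> cylinder k ?l"
    using \<omega> by (auto simp: prefixes_def cylinder_def simp del: upt_Suc)
  then show "\<omega> \<in> (\<Union>l\<in>prefixes k D. cylinder k l)" by blast
next
  fix \<omega> assume "\<omega> \<in> (\<Union>l\<in>prefixes k D. cylinder k l)"
  then obtain l \<omega>' where "\<omega> \<in> cylinder k l" "\<omega>' \<in> space M" "D \<omega>'" "\<forall>i\<le>k. S i \<omega>' = l ! i"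
    by (auto simp: prefixes_def)
  moreover from this have "\<forall>i\<le>k. S i \<omega> = S i \<omega>'" by (simp add: cylinder_def)
  with assms have "D \<omega> = D \<omega>'" unfolding past_def by blast
  ultimately show "\<omega> \<in> {\<omega> \<in> space M. D \<omega>}" by (simp add: cylinder_def)
qed

lemma past_sets [measurable (raw)]: "past k D \<Longrightarrow> {\<omega> \<in> space M. D \<omega>} \<in> sets M"
  by (subst past_eq_UN) (auto intro!: sets.countable_UN')

text \<open>Split \<open>D\<close> into cylinders: each of them ends at \<open>x\<close>, so the
  defining property of the walk gives the same factor for all, and countable additivity reassembles
  the event.\<close>

lemma emeasure_step:
  assumes D: "past k D" and x: "\<And>\<omega>. D \<omega> \<Longrightarrow> S k \<omega> = x"
  shows "emeasure M {\<omega> \<in> space M. D \<omega> \<and> S (Suc k) \<omega> = y} =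
    emeasure M {\<omega> \<in> space M. D \<omega>} * ennreal (pmf (srw_step x) y)"
proof -
  let ?Y = "{\<omega> \<in> space M. S (Suc k) \<omega> = y}"
  have step: "emeasure M (cylinder k l \<inter> ?Y) = emeasure M (cylinder k l) * ennreal (pmf (srw_step x) y)"
    if l: "l \<in> prefixes k D" for l
  proof -
    have lk: "l ! k = x" using l x by (auto simp: prefixes_def)
    have "cylinder k l \<inter> ?Y = {\<omega> \<in> space M. (\<forall>i\<le>k. S i \<omega> = l ! i) \<and> S (Suc k) \<omega> = y}"
      by (auto simp: cylinder_def)
    moreover have "measure M {\<omega> \<in> space M. (\<forall>i\<le>k. S i \<omega> = l ! i) \<and> S (Suc k) \<omega> = y} =
        measure M {\<omega> \<in> space M. \<forall>i\<le>k. S i \<omega> = l ! i} * pmf (srw_step (l ! k)) y"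
      using srw unfolding aperiodic_srw_def by (elim conjE) (drule spec | assumption)+
    ultimately show ?thesis
      by (simp add: emeasure_eq_measure cylinder_def lk ennreal_mult)
  qed
  have "emeasure M {\<omega> \<in> space M. D \<omega> \<and> S (Suc k) \<omega> = y} = emeasure M (\<Union>l\<in>prefixes k D. cylinder k l \<inter> ?Y)"
    using past_eq_UN[OF D] by (intro arg_cong[where f = "emeasure M"]) blast
  also have "\<dots> = (\<integral>\<^sup>+l. emeasure M (cylinder k l \<inter> ?Y) \<partial>count_space (prefixes k D))"
    by (intro emeasure_UN_countable disjoint_cylinders) auto
  also have "\<dots> = (\<integral>\<^sup>+l. emeasure M (cylinder k l) * ennreal (pmf (srw_step x) y) \<partial>count_space (prefixes k D))"
    by (intro nn_integral_cong step) simp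
  also have "\<dots> = (\<integral>\<^sup>+l. emeasure M (cylinder k l) \<partial>count_space (prefixes k D)) * ennreal (pmf (srw_step x) y)"
    by (simp add: nn_integral_multc)
  also have "(\<integral>\<^sup>+l. emeasure M (cylinder k l) \<partial>count_space (prefixes k D)) = emeasure M (\<Union>l\<in>prefixes k D. cylinder k l)"
    using disjoint_cylinders[of k UNIV] by (intro emeasure_UN_countable[symmetric]) auto
  also have "\<dots> = emeasure M {\<omega> \<in> space M. D \<omega>}"
    using past_eq_UN[OF D] by simp
  finally show ?thesis .
qed

text \<open>Condition on the position \<open>w\<close> one step before the end; \<open>D\<close>
  together with that position is again an event of the past, so \<open>emeasure_step\<close>
  applies.\<close>

lemma emeasure_transition:
  assumes D: "past k D" and x: "\<And>\<omega>. D \<omega> \<Longrightarrow> S k \<omega> = x"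
  shows "emeasure M {\<omega> \<in> space M. D \<omega> \<and> S (k + r) \<omega> = y} =
    emeasure M {\<omega> \<in> space M. D \<omega>} * ennreal (heat r (y - x))"
proof (induction r arbitrary: y)
  case 0
  have "{\<omega> \<in> space M. D \<omega> \<and> S (k + 0) \<omega> = y} = (if y = x then {\<omega> \<in> space M. D \<omega>} else {})"
    using x by auto
  then show ?case by simp
next
  case (Suc r)
  have past: "past (k + r) (\<lambda>\<omega>. D \<omega> \<and> S (k + r) \<omega> = w)" for w
    by (intro past_conj past_at past_mono[OF D]) auto
  have sets: "{\<omega> \<in> space M. (D \<omega> \<and> S (k + r) \<omega> = w) \<and> S (Suc (k + r)) \<omega> = y} \<in> sets M" for w
    by (intro past_sets[of "Suc (k + r)"] past_conj past_mono[OF D] past_at) auto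
  have "emeasure M {\<omega> \<in> space M. D \<omega> \<and> S (k + Suc r) \<omega> = y} =
      emeasure M (\<Union>w. {\<omega> \<in> space M. (D \<omega> \<and> S (k + r) \<omega> = w) \<and> S (Suc (k + r)) \<omega> = y})"
    by (intro arg_cong[where f = "emeasure M"]) auto
  also have "\<dots> = (\<integral>\<^sup>+w. emeasure M {\<omega> \<in> space M. (D \<omega> \<and> S (k + r) \<omega> = w) \<and> S (Suc (k + r)) \<omega> = y} \<partial>count_space UNIV)"
    by (intro emeasure_UN_countable sets) (auto simp: disjoint_family_on_def)
  also have "\<dots> = (\<integral>\<^sup>+w. emeasure M {\<omega> \<in> space M. D \<omega>} * (ennreal (heat r (w - x)) * ennreal (pmf (srw_step w) y)) \<partial>count_space UNIV)"
    by (intro nn_integral_cong) (subst emeasure_step[OF past], auto simp: Suc mult.assoc)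
  also have "\<dots> = emeasure M {\<omega> \<in> space M. D \<omega>} * ennreal (heat (Suc r) (y - x))"
    by (simp only: nn_integral_cmult[OF borel_measurable_count_space] nn_integral_heat_step)
  finally show ?case .
qed

text \<open>Induction over the sites, with the past event general: once the first visit time
  \<open>k\<close> is chosen, \<open>D\<close> and the visit together form a past event at time
  \<open>k\<close>. Summing the transition probabilities over \<open>k\<close> from
  \<open>k0\<close> on yields \<open>green\<close>. Equal times must be allowed, since sites may
  repeat.\<close>

lemma emeasure_visits_sorted:
  assumes "past k0 D" "\<And>\<omega>. D \<omega> \<Longrightarrow> S k0 \<omega> = x"
  shows "(\<integral>\<^sup>+ks. of_bool (sorted (k0 # ks)) *
      emeasure M {\<omega> \<in> space M. D \<omega> \<and> list_all2 (\<lambda>k z. S k \<omega> = z) ks zs}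
      \<partial>count_space {ks. length ks = length zs}) = emeasure M {\<omega> \<in> space M. D \<omega>} * chain x zs"
  using assms
proof (induction zs arbitrary: k0 D x)
  case Nil
  then show ?case by (simp add: nn_integral_count_space_length_0[simplified])
next
  case (Cons z zs)
  have bij: "bij_betw (\<lambda>r. k0 + r) UNIV {k0..}"
    by (rule bij_betwI[where g = "\<lambda>k. k - k0"]) auto
  have IH: "(\<integral>\<^sup>+ks. of_bool (sorted (k # ks)) *
      emeasure M {\<omega> \<in> space M. (D \<omega> \<and> S k \<omega> = z) \<and> list_all2 (\<lambda>k z. S k \<omega> = z) ks zs}
      \<partial>count_space {ks. length ks = length zs}) = emeasure M {\<omega> \<in> space M. D \<omega> \<and> S k \<omega> = z} * chain z zs"
    if "k0 \<le> k" for k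
    using that by (intro Cons.IH past_conj past_mono[OF Cons.prems(1)] past_at) auto
  have "(\<integral>\<^sup>+ks. of_bool (sorted (k0 # ks)) *
      emeasure M {\<omega> \<in> space M. D \<omega> \<and> list_all2 (\<lambda>k z. S k \<omega> = z) ks (z # zs)}
      \<partial>count_space {ks. length ks = length (z # zs)}) =
    (\<integral>\<^sup>+k. (\<integral>\<^sup>+ks. of_bool (sorted (k0 # k # ks)) *
      emeasure M {\<omega> \<in> space M. D \<omega> \<and> list_all2 (\<lambda>k z. S k \<omega> = z) (k # ks) (z # zs)}
      \<partial>count_space {ks. length ks = length zs}) \<partial>count_space UNIV)"
    by (simp only: list.size add_Suc_right add_0_right nn_integral_count_space_Suc_length)
  also have "\<dots> = (\<integral>\<^sup>+k. indicator {k0..} k * (\<integral>\<^sup>+ks. of_bool (sorted (k # ks)) *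
      emeasure M {\<omega> \<in> space M. (D \<omega> \<and> S k \<omega> = z) \<and> list_all2 (\<lambda>k z. S k \<omega> = z) ks zs}
      \<partial>count_space {ks. length ks = length zs}) \<partial>count_space UNIV)"
  proof (intro nn_integral_cong, subst nn_integral_cmult[symmetric], simp, intro nn_integral_cong)
    fix k ks
    show "of_bool (sorted (k0 # k # ks)) *
      emeasure M {\<omega> \<in> space M. D \<omega> \<and> list_all2 (\<lambda>k z. S k \<omega> = z) (k # ks) (z # zs)} =
      indicator {k0..} k * (of_bool (sorted (k # ks)) *
      emeasure M {\<omega> \<in> space M. (D \<omega> \<and> S k \<omega> = z) \<and> list_all2 (\<lambda>k z. S k \<omega> = z) ks zs})"
      by (auto simp: indicator_def conj_assoc)
  qed
  also have "\<dots> = (\<integral>\<^sup>+k. emeasure M {\<omega> \<in> space M. D \<omega> \<and> S k \<omega> = z} * chain z zs * indicator {k0..} k \<partial>count_space UNIV)"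
  proof (rule nn_integral_cong)
    fix k
    show "indicator {k0..} k * (\<integral>\<^sup>+ks. of_bool (sorted (k # ks)) *
      emeasure M {\<omega> \<in> space M. (D \<omega> \<and> S k \<omega> = z) \<and> list_all2 (\<lambda>k z. S k \<omega> = z) ks zs}
      \<partial>count_space {ks. length ks = length zs}) =
      emeasure M {\<omega> \<in> space M. D \<omega> \<and> S k \<omega> = z} * chain z zs * indicator {k0..} k"
      using IH[of k] by (cases "k0 \<le> k") simp_all
  qed
  also have "\<dots> = (\<integral>\<^sup>+k. emeasure M {\<omega> \<in> space M. D \<omega> \<and> S k \<omega> = z} * chain z zs \<partial>count_space {k0..})"
    by (simp add: nn_integral_count_space_indicator)
  also have "\<dots> = (\<integral>\<^sup>+r. emeasure M {\<omega> \<in> space M. D \<omega> \<and> S (k0 + r) \<omega> = z} * chain z zs \<partial>count_space UNIV)"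
    by (rule nn_integral_bij_count_space[OF bij, symmetric])
  also have "\<dots> = emeasure M {\<omega> \<in> space M. D \<omega>} * chain x (z # zs)"
    by (simp add: emeasure_transition[OF Cons.prems] nn_integral_cmult nn_integral_multc green_def mult.assoc)
  finally show ?case .
qed

text \<open>Every list of times is sorted by some permutation, and permuting times and sites
  together leaves the event unchanged. A list with ties is sorted by several permutations, hence the
  inequality.\<close>

lemma emeasure_visits_le:
  "(\<integral>\<^sup>+ks. emeasure M {\<omega> \<in> space M. list_all2 (\<lambda>k z. S k \<omega> = z) ks zs}
     \<partial>count_space {ks. length ks = length zs}) \<le>
   (\<Sum>p | p permutes {..<length zs}. chain 0 (permute_list p zs))"
proof -
  let ?n = "length zs"
  let ?L = "{ks :: nat list. length ks = ?n}"
  let ?F = "\<lambda>ks zs. emeasure M {\<omega> \<in> space M. list_all2 (\<lambda>k z. S k \<omega> = z) ks zs}"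
  have sorted_sum: "(\<integral>\<^sup>+ks. of_bool (sorted ks) * ?F ks zs \<partial>count_space {ks. length ks = length zs}) = chain 0 zs" for zs
  proof -
    have AE: "AE \<omega> in M. S 0 \<omega> = 0" using srw by (simp add: aperiodic_srw_def)
    \<comment> \<open>The start at \<open>0\<close> holds almost surely; adding it to the event
      supplies the initial past event at time \<open>0\<close>.\<close>
    have "?F ks zs = emeasure M {\<omega> \<in> space M. S 0 \<omega> = 0 \<and> list_all2 (\<lambda>k z. S k \<omega> = z) ks zs}" for ks
    proof (rule emeasure_eq_AE)
      show "AE \<omega> in M. (\<omega> \<in> {\<omega> \<in> space M. list_all2 (\<lambda>k z. S k \<omega> = z) ks zs}) =
          (\<omega> \<in> {\<omega> \<in> space M. S 0 \<omega> = 0 \<and> list_all2 (\<lambda>k z. S k \<omega> = z) ks zs})"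
        using AE by eventually_elim simp
    qed (simp_all add: list_all2_conv_all_nth)
    then show ?thesis
      using emeasure_visits_sorted[of 0 "\<lambda>\<omega>. S 0 \<omega> = 0" 0 zs] by (simp add: past_at emeasure_start)
  qed
  have "(\<integral>\<^sup>+ks. ?F ks zs \<partial>count_space ?L)
    \<le> (\<integral>\<^sup>+ks. (\<Sum>p | p permutes {..<?n}. of_bool (sorted (permute_list p ks)) * ?F ks zs) \<partial>count_space ?L)"
  proof (rule nn_integral_mono)
    fix ks :: "nat list" assume "ks \<in> space (count_space ?L)"
    then have len: "length ks = ?n" by simp
    obtain p where p: "p permutes {..<length ks}" "permute_list p ks = sort ks"
      by (rule mset_eq_permutation[of "sort ks" ks]) auto
    have "?F ks zs = of_bool (sorted (permute_list p ks)) * ?F ks zs"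
      using p by simp
    also have "\<dots> \<le> (\<Sum>p | p permutes {..<?n}. of_bool (sorted (permute_list p ks)) * ?F ks zs)"
      using p len by (intro member_le_sum) (auto simp: finite_permutations)
    finally show "?F ks zs \<le> \<dots>" .
  qed
  also have "\<dots> = (\<Sum>p | p permutes {..<?n}. \<integral>\<^sup>+ks. of_bool (sorted (permute_list p ks)) * ?F ks zs \<partial>count_space ?L)"
    by (rule nn_integral_sum) simp
  also have "\<dots> = (\<Sum>p | p permutes {..<?n}. chain 0 (permute_list p zs))"
  proof (rule sum.cong[OF refl])
    fix p assume "p \<in> {p. p permutes {..<?n}}"
    then have p: "p permutes {..<?n}" by simp
    note bij = bij_betw_permute_list[OF p]
    have "(\<integral>\<^sup>+ks. of_bool (sorted (permute_list p ks)) * ?F ks zs \<partial>count_space ?L)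
        = (\<integral>\<^sup>+ks. of_bool (sorted (permute_list p ks)) * ?F (permute_list p ks) (permute_list p zs) \<partial>count_space ?L)"
      using p by (intro nn_integral_cong) (simp add: list_all2_permute_list_iff)
    also have "\<dots> = (\<integral>\<^sup>+ks. of_bool (sorted ks) * ?F ks (permute_list p zs) \<partial>count_space ?L)"
      by (rule nn_integral_bij_count_space[OF bij])
    also have "\<dots> = chain 0 (permute_list p zs)"
      using sorted_sum[of "permute_list p zs"] by simp
    finally show "(\<integral>\<^sup>+ks. of_bool (sorted (permute_list p ks)) * ?F ks zs \<partial>count_space ?L) = chain 0 (permute_list p zs)" .
  qed
  finally show ?thesis .
qed

end

subsection \<open>Moments and tail\<close>

lemma local_time_eq_nn_integral:
  "local_time x = (\<lambda>z. \<integral>\<^sup>+k. indicator {z} (x k) \<partial>count_space UNIV)"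
  by (simp add: fun_eq_iff local_time_def nn_integral_count_space_nat)

lemma measurable_local_time [measurable]:
  "(\<lambda>x. local_time x z) \<in> borel_measurable (PiM UNIV (\<lambda>_. count_space UNIV))"
  unfolding local_time_def by measurable

lemma measurable_prod_list_map [measurable (raw)]:
  fixes f :: "'c \<Rightarrow> 'b \<Rightarrow> ennreal"
  assumes "\<And>z. f z \<in> borel_measurable M"
  shows "(\<lambda>x. prod_list (map (\<lambda>z. f z x) zs)) \<in> borel_measurable M"
  using assms by (induction zs) auto

lemma prod_list_map_mult:
  fixes f g :: "'b \<Rightarrow> 'c::comm_monoid_mult"
  shows "prod_list (map (\<lambda>z. f z * g z) zs) = prod_list (map f zs) * prod_list (map g zs)"
  by (induction zs) (simp_all add: ac_simps)

definition visit_bound :: "(int ^ 'd::finite) list \<Rightarrow> ennreal" where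
  "visit_bound zs = (\<Sum>p | p permutes {..<length zs}. chain 0 (permute_list p zs))"

text \<open>Multiplying out the local times gives, for each list of times, the indicator that all
  the sites are visited at these times; its expectation is summed in
  \<open>emeasure_visits_le\<close>.\<close>

lemma (in srw_walk) nn_integral_local_times_le:
  "(\<integral>\<^sup>+\<omega>. prod_list (map (local_time (\<lambda>n. S n \<omega>)) zs) \<partial>M) \<le> visit_bound zs"
proof -
  have prod_eq: "prod_list (map2 (\<lambda>z k. indicator {z} (S k \<omega>)) zs ks) =
      (indicator {\<omega> \<in> space M. list_all2 (\<lambda>k z. S k \<omega> = z) ks zs} \<omega> :: ennreal)"
    if "length ks = length zs" "\<omega> \<in> space M" for ks \<omega>
    using that by (induction ks zs rule: list_induct2) (auto simp: indicator_def)
  have "(\<integral>\<^sup>+\<omega>. prod_list (map (local_time (\<lambda>n. S n \<omega>)) zs) \<partial>M) =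
      (\<integral>\<^sup>+\<omega>. (\<integral>\<^sup>+ks. prod_list (map2 (\<lambda>z k. indicator {z} (S k \<omega>)) zs ks)
        \<partial>count_space {ks. length ks = length zs}) \<partial>M)"
    by (simp add: local_time_eq_nn_integral prod_list_nn_integral_count_space)
  also have "\<dots> = (\<integral>\<^sup>+\<omega>. (\<integral>\<^sup>+ks. indicator {\<omega> \<in> space M. list_all2 (\<lambda>k z. S k \<omega> = z) ks zs} \<omega>
        \<partial>count_space {ks. length ks = length zs}) \<partial>M)"
    by (intro nn_integral_cong) (simp add: prod_eq)
  also have "\<dots> = (\<integral>\<^sup>+ks. (\<integral>\<^sup>+\<omega>. indicator {\<omega> \<in> space M. list_all2 (\<lambda>k z. S k \<omega> = z) ks zs} \<omega> \<partial>M)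
        \<partial>count_space {ks. length ks = length zs})"
    by (intro nn_integral_count_space_nn_integral) (auto simp: list_all2_conv_all_nth)
  also have "\<dots> = (\<integral>\<^sup>+ks. emeasure M {\<omega> \<in> space M. list_all2 (\<lambda>k z. S k \<omega> = z) ks zs}
        \<partial>count_space {ks. length ks = length zs})"
    by (intro nn_integral_cong nn_integral_indicator) (simp add: list_all2_conv_all_nth)
  also have "\<dots> \<le> visit_bound zs"
    unfolding visit_bound_def by (rule emeasure_visits_le)
  finally show ?thesis .
qed

text \<open>Convexity costs a factor \<open>fact n powr (q - 1)\<close> for a sum of
  \<open>fact n\<close> terms. The terms all have the same total, because permuting coordinates is a
  bijection of the \<open>n\<close>-tuples; this supplies the remaining factor
  \<open>fact n\<close>.\<close>

lemma nn_integral_visit_bound_powr_le: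
  assumes q: "1 \<le> q"
  shows "(\<integral>\<^sup>+zs. ennpowr (visit_bound (zs :: (int ^ 'd::finite) list)) q \<partial>count_space {zs. length zs = n}) \<le>
    ennreal (fact n powr q) * (\<integral>\<^sup>+z. ennpowr (green (z :: int ^ 'd)) q \<partial>count_space UNIV) ^ n"
proof -
  let ?L = "{zs :: (int ^ 'd) list. length zs = n}"
  let ?P = "{p. p permutes {..<n}}"
  let ?K = "\<integral>\<^sup>+z. ennpowr (green (z :: int ^ 'd)) q \<partial>count_space UNIV"
  have P: "finite ?P" "?P \<noteq> {}" "card ?P = fact n"
    using permutes_id[of "{..<n}"] by (auto simp: finite_permutations card_permutations simp del: permutes_id)
  have "(\<integral>\<^sup>+zs. ennpowr (visit_bound zs) q \<partial>count_space ?L) \<le>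
      (\<integral>\<^sup>+zs. ennreal (fact n powr (q - 1)) * (\<Sum>p\<in>?P. ennpowr (chain 0 (permute_list p zs)) q) \<partial>count_space ?L)"
    using ennpowr_sum_le[OF P(1,2) q] by (intro nn_integral_mono) (simp add: visit_bound_def P(3))
  also have "\<dots> = ennreal (fact n powr (q - 1)) * (\<Sum>p\<in>?P. \<integral>\<^sup>+zs. ennpowr (chain 0 (permute_list p zs)) q \<partial>count_space ?L)"
    by (simp add: nn_integral_cmult nn_integral_sum)
  also have "(\<Sum>p\<in>?P. \<integral>\<^sup>+zs. ennpowr (chain 0 (permute_list p zs)) q \<partial>count_space ?L) = (\<Sum>p\<in>?P. ?K ^ n)"
  proof (rule sum.cong[OF refl])
    fix p assume "p \<in> ?P"
    then have "(\<integral>\<^sup>+zs. ennpowr (chain 0 (permute_list p zs)) q \<partial>count_space ?L) = (\<integral>\<^sup>+zs. ennpowr (chain 0 zs) q \<partial>count_space ?L)"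
      by (intro nn_integral_bij_count_space bij_betw_permute_list) simp
    then show "(\<integral>\<^sup>+zs. ennpowr (chain 0 (permute_list p zs)) q \<partial>count_space ?L) = ?K ^ n"
      by (simp add: nn_integral_chain_powr)
  qed
  also have "ennreal (fact n powr (q - 1)) * (\<Sum>p\<in>?P. ?K ^ n) = ennreal (fact n powr (q - 1)) * ennreal (fact n) * ?K ^ n"
    by (simp add: P(3) ennreal_of_nat_eq_real_of_nat mult.assoc)
  also have "ennreal (fact n powr (q - 1)) * ennreal (fact n) = ennreal (fact n powr q)"
    by (simp add: ennreal_mult[symmetric] powr_diff)
  finally show ?thesis .
qed

text \<open>Equal to \<^const>\<open>zeta\<close>, but measurable by general rules on integrals; only the upper bound
  \<open>zeta \<le> zeta_int\<close> is needed.\<close>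

definition zeta_int :: "real \<Rightarrow> (nat \<Rightarrow> int ^ 'd::finite) \<Rightarrow> (nat \<Rightarrow> int ^ 'd) \<Rightarrow> ennreal" where
  "zeta_int q x y = (\<integral>\<^sup>+z. local_time x z * ennpowr (local_time y z) (q - 1) \<partial>count_space UNIV)"

lemma zeta_le_zeta_int: "zeta q x y \<le> zeta_int q x y"
  unfolding zeta_def zeta_int_def by (rule infsum_le_nn_integral_count_space)

locale two_walks = prob_space M for M :: "'a measure" +
  fixes S S' :: "nat \<Rightarrow> 'a \<Rightarrow> int ^ 'd::finite"
  assumes two_indep: "two_indep_srw M S S'"
begin

sublocale S: srw_walk M S
  using two_indep by unfold_locales (simp add: two_indep_srw_def)

sublocale S': srw_walk M S'
  using two_indep by unfold_locales (simp add: two_indep_srw_def)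

lemma indep_paths:
  "indep_var (PiM UNIV (\<lambda>_. count_space UNIV)) (\<lambda>\<omega> n. S n \<omega>) (PiM UNIV (\<lambda>_. count_space UNIV)) (\<lambda>\<omega> n. S' n \<omega>)"
  using two_indep by (simp add: two_indep_srw_def)

lemma measurable_local_time_walk [measurable]:
  "(\<lambda>\<omega>. local_time (\<lambda>n. S n \<omega>) z) \<in> borel_measurable M"
  "(\<lambda>\<omega>. local_time (\<lambda>n. S' n \<omega>) z) \<in> borel_measurable M"
  unfolding local_time_def by measurable

lemma measurable_zeta_int [measurable]:
  "(\<lambda>\<omega>. zeta_int q (\<lambda>n. S n \<omega>) (\<lambda>n. S' n \<omega>)) \<in> borel_measurable M"
  unfolding zeta_int_def by measurable

lemma nn_integral_zeta_int_power_le: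
  assumes q: "1 < q" "q \<le> 2"
  shows "(\<integral>\<^sup>+\<omega>. zeta_int q (\<lambda>n. S n \<omega>) (\<lambda>n. S' n \<omega>) ^ n \<partial>M) \<le>
    ennreal (fact n powr q) * (\<integral>\<^sup>+z. ennpowr (green (z :: int ^ 'd)) q \<partial>count_space UNIV) ^ n"
proof -
  let ?l = "\<lambda>zs x. prod_list (map (local_time x) zs)"
  have meas: "?l zs \<in> borel_measurable (PiM UNIV (\<lambda>_. count_space UNIV))" for zs :: "(int ^ 'd) list"
    by measurable
  have "(\<integral>\<^sup>+\<omega>. zeta_int q (\<lambda>n. S n \<omega>) (\<lambda>n. S' n \<omega>) ^ n \<partial>M) =
      (\<integral>\<^sup>+\<omega>. (\<integral>\<^sup>+zs. ?l zs (\<lambda>n. S n \<omega>) * ennpowr (?l zs (\<lambda>n. S' n \<omega>)) (q - 1)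
        \<partial>count_space {zs. length zs = n}) \<partial>M)"
    by (simp add: zeta_int_def power_nn_integral_count_space prod_list_map_mult ennpowr_prod_list o_def)
  also have "\<dots> = (\<integral>\<^sup>+zs. (\<integral>\<^sup>+\<omega>. ?l zs (\<lambda>n. S n \<omega>) * ennpowr (?l zs (\<lambda>n. S' n \<omega>)) (q - 1) \<partial>M)
        \<partial>count_space {zs. length zs = n})"
    by (intro nn_integral_count_space_nn_integral) auto
  also have "\<dots> \<le> (\<integral>\<^sup>+zs. ennpowr (visit_bound (zs :: (int ^ 'd) list)) q \<partial>count_space {zs. length zs = n})"
  proof (rule nn_integral_mono)
    fix zs :: "(int ^ 'd) list"
    have "(\<integral>\<^sup>+\<omega>. ?l zs (\<lambda>n. S n \<omega>) * ennpowr (?l zs (\<lambda>n. S' n \<omega>)) (q - 1) \<partial>M) =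
        (\<integral>\<^sup>+\<omega>. ?l zs (\<lambda>n. S n \<omega>) \<partial>M) * (\<integral>\<^sup>+\<omega>. ennpowr (?l zs (\<lambda>n. S' n \<omega>)) (q - 1) \<partial>M)"
      by (rule indep_var_nn_integral_mult[OF indep_paths, of "?l zs" "\<lambda>x. ennpowr (?l zs x) (q - 1)"])
        (auto intro: meas measurable_compose[OF meas measurable_ennpowr])
    also have "\<dots> \<le> visit_bound zs * ennpowr (visit_bound zs) (q - 1)"
    proof (rule mult_mono)
      \<comment> \<open>Concavity of the power \<open>q - 1\<close>, by
        \<open>q \<le> 2\<close>.\<close>
      have "(\<integral>\<^sup>+\<omega>. ennpowr (?l zs (\<lambda>n. S' n \<omega>)) (q - 1) \<partial>M) \<le> ennpowr (\<integral>\<^sup>+\<omega>. ?l zs (\<lambda>n. S' n \<omega>) \<partial>M) (q - 1)"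
        using q by (intro nn_integral_ennpowr_le) auto
      also have "\<dots> \<le> ennpowr (visit_bound zs) (q - 1)"
        using q by (intro ennpowr_mono S'.nn_integral_local_times_le) simp
      finally show "(\<integral>\<^sup>+\<omega>. ennpowr (?l zs (\<lambda>n. S' n \<omega>)) (q - 1) \<partial>M) \<le> ennpowr (visit_bound zs) (q - 1)" .
    qed (use S.nn_integral_local_times_le in auto)
    also have "\<dots> = ennpowr (visit_bound zs) q"
      using ennpowr_add[of 1 "q - 1" "visit_bound zs"] q by simp
    finally show "(\<integral>\<^sup>+\<omega>. ?l zs (\<lambda>n. S n \<omega>) * ennpowr (?l zs (\<lambda>n. S' n \<omega>)) (q - 1) \<partial>M) \<le> ennpowr (visit_bound zs) q" .
  qed
  also have "\<dots> \<le> ennreal (fact n powr q) * (\<integral>\<^sup>+z. ennpowr (green (z :: int ^ 'd)) q \<partial>count_space UNIV) ^ n"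
    using q by (intro nn_integral_visit_bound_powr_le) simp
  finally show ?thesis .
qed

lemma prob_zeta_gt_le:
  assumes q: "1 < q" "q \<le> 2"
    and K: "(\<integral>\<^sup>+z. ennpowr (green (z :: int ^ 'd)) q \<partial>count_space UNIV) \<le> ennreal K" "0 < K"
    and t: "0 < t"
  shows "measure M {\<omega> \<in> space M. zeta q (\<lambda>n. S n \<omega>) (\<lambda>n. S' n \<omega>) > ennreal t} \<le>
    exp (1 - (t / (exp 1 * K)) powr (1 / q))"
proof -
  \<comment> \<open>Since \<open>fact n \<le> n ^ n\<close>, the \<open>n\<close>-th moment bound
    divided by \<open>t ^ n\<close> is at most \<open>(n powr q * K / t) ^ n\<close>. This choice
    makes the base at most \<open>exp (- 1)\<close>, and rounding down costs the \<open>1\<close> in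
    the exponent.\<close>
  define n where "n = nat \<lfloor>(t / (exp 1 * K)) powr (1 / q)\<rfloor>"
  have n: "real n \<le> (t / (exp 1 * K)) powr (1 / q)" "(t / (exp 1 * K)) powr (1 / q) - 1 \<le> real n"
    unfolding n_def by (simp_all add: of_nat_nat)
  let ?Z = "\<lambda>\<omega>. zeta_int q (\<lambda>n. S n \<omega>) (\<lambda>n. S' n \<omega>)"
  let ?A = "{\<omega> \<in> space M. ennreal t ^ n \<le> ?Z \<omega> ^ n}"
  have A: "?A \<in> sets M" by measurable
  have "measure M {\<omega> \<in> space M. zeta q (\<lambda>n. S n \<omega>) (\<lambda>n. S' n \<omega>) > ennreal t} \<le> measure M ?A"
  proof (intro finite_measure_mono A subsetI)
    fix \<omega> assume \<omega>: "\<omega> \<in> {\<omega> \<in> space M. zeta q (\<lambda>n. S n \<omega>) (\<lambda>n. S' n \<omega>) > ennreal t}"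
    then have "ennreal t \<le> ?Z \<omega>"
      by (intro order_trans[OF less_imp_le zeta_le_zeta_int]) simp
    then show "\<omega> \<in> ?A" using \<omega> by (simp add: power_mono)
  qed
  also have "measure M ?A \<le> fact n powr q * K ^ n / t ^ n"
  proof -
    have "t ^ n * measure M ?A \<le> fact n powr q * K ^ n"
    proof -
      have "ennreal t ^ n * emeasure M ?A = (\<integral>\<^sup>+\<omega>. ennreal t ^ n * indicator ?A \<omega> \<partial>M)"
        using A by (simp add: nn_integral_cmult_indicator)
      also have "\<dots> \<le> (\<integral>\<^sup>+\<omega>. ?Z \<omega> ^ n \<partial>M)"
        by (intro nn_integral_mono) (auto split: split_indicator)
      also have "\<dots> \<le> ennreal (fact n powr q) * ennreal K ^ n"
        using nn_integral_zeta_int_power_le[OF q, of n]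
        by (rule order_trans) (intro mult_left_mono power_mono K, auto)
      finally show ?thesis
        using t K by (simp add: emeasure_eq_measure ennreal_power ennreal_mult[symmetric])
    qed
    then show ?thesis
      using t by (simp add: field_simps)
  qed
  also have "\<dots> \<le> (real n ^ n) powr q * K ^ n / t ^ n"
    using t K q fact_le_power[of n]
    by (intro divide_right_mono mult_right_mono powr_mono2) auto
  also have "\<dots> = (real n powr q * (K / t)) ^ n"
  proof -
    have "(real n ^ m) powr q = (real n powr q) ^ m" for m
      by (induction m) (simp_all add: powr_mult)
    then show ?thesis by (simp add: power_mult_distrib power_divide)
  qed
  also have "\<dots> \<le> (exp (- 1)) ^ n"
  proof (rule power_mono)
    have "real n powr q \<le> ((t / (exp 1 * K)) powr (1 / q)) powr q"
      using n q by (intro powr_mono2) auto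
    also have "\<dots> = t / (exp 1 * K)"
      using q t K by (simp add: powr_powr)
    finally have "real n powr q * (K / t) \<le> t / (exp 1 * K) * (K / t)"
      using t K by (intro mult_right_mono) auto
    then show "real n powr q * (K / t) \<le> exp (- 1)"
      using t K by (simp add: exp_minus field_simps)
  qed (use t K in auto)
  also have "\<dots> = exp (- real n)"
    by (simp flip: exp_of_nat_mult)
  also have "\<dots> \<le> exp (1 - (t / (exp 1 * K)) powr (1 / q))"
    using n by simp
  finally show ?thesis by linarith
qed

end

subsection \<open>Walks that never meet again\<close>

lemma abs_component_le_l1_norm: "\<bar>z $ i\<bar> \<le> l1_norm z"
  unfolding l1_norm_def by (rule member_le_sum) auto

context srw_walk
begin

text \<open>The sign \<open>s\<close> lets one definition serve both walks, which are sent in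
  opposite directions along the same axis.\<close>

definition straight :: "'d \<Rightarrow> int \<Rightarrow> nat \<Rightarrow> 'a \<Rightarrow> bool" where
  "straight i s m \<omega> \<longleftrightarrow> (\<forall>j\<le>m. S j \<omega> = axis i (s * int j))"

lemma past_straight: "past m (straight i s m)"
  unfolding past_def straight_def by auto

lemma straight_end: "straight i s m \<omega> \<Longrightarrow> S m \<omega> = axis i (s * int m)"
  by (simp add: straight_def)

lemma prob_straight:
  assumes "\<bar>s\<bar> = 1"
  shows "emeasure M {\<omega> \<in> space M. straight i s m \<omega>} = ennreal ((1 / (2 * real CARD('d) + 1)) ^ m)"
proof (induction m)
  case 0
  have ax: "(axis i 0 :: int ^ 'd) = 0" by (simp add: axis_eq_0_iff)
  show ?case using emeasure_start by (simp add: straight_def ax)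
next
  case (Suc m)
  have "straight i s (Suc m) \<omega> \<longleftrightarrow> straight i s m \<omega> \<and> S (Suc m) \<omega> = axis i (s * int (Suc m))" for \<omega>
    unfolding straight_def by (metis le_Suc_eq)
  moreover have "(axis i (s * int (Suc m)) - axis i (s * int m) :: int ^ 'd) = axis i s"
    by (simp add: vec_eq_iff axis_def algebra_simps)
  ultimately show ?case
    using assms
    by (simp only: emeasure_step[OF past_straight straight_end] Suc pmf_srw_step l1_norm_axis)
      (simp add: ennreal_mult[symmetric] mult.commute)
qed

text \<open>Longer jumps have transition probability zero, and there are only countably many triples
  of a time and two sites to exclude.\<close>

lemma AE_step_le:
  "AE \<omega> in M. \<forall>n. l1_norm (S (Suc n) \<omega> - S n \<omega>) \<le> 1"
proof -
  have null: "AE \<omega> in M. \<not> (S n \<omega> = x \<and> S (Suc n) \<omega> = y)" if "\<not> l1_norm (y - x) \<le> 1" for n x y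
  proof -
    have "emeasure M {\<omega> \<in> space M. S n \<omega> = x \<and> S (Suc n) \<omega> = y} = 0"
      using emeasure_step[OF past_at[of n n x], of x y] that by (simp add: pmf_srw_step)
    then show ?thesis by (subst AE_iff_measurable[OF _ refl]) auto
  qed
  have "\<forall>n x y. AE \<omega> in M. S n \<omega> = x \<and> S (Suc n) \<omega> = y \<longrightarrow> l1_norm (y - x) \<le> 1"
  proof (intro allI)
    fix n x y
    show "AE \<omega> in M. S n \<omega> = x \<and> S (Suc n) \<omega> = y \<longrightarrow> l1_norm (y - x) \<le> 1"
      using null[of y x n] by (cases "l1_norm (y - x) \<le> 1") auto
  qed
  then have "AE \<omega> in M. \<forall>n x y. S n \<omega> = x \<and> S (Suc n) \<omega> = y \<longrightarrow> l1_norm (y - x) \<le> 1"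
    unfolding AE_all_countable .
  then show ?thesis by eventually_elim auto
qed

text \<open>At time \<open>m\<close> the walk is at distance \<open>m\<close> from the hyperplane
  where coordinate \<open>i\<close> vanishes, and each step changes that coordinate by at most 1, so
  the hyperplane cannot be reached again before time \<open>2 * m\<close>.\<close>

lemma straight_positive:
  assumes st: "straight i s m \<omega>" and le: "\<forall>n. l1_norm (S (Suc n) \<omega> - S n \<omega>) \<le> 1"
    and s: "\<bar>s\<bar> = 1" and j: "0 < j" "j < 2 * m"
  shows "0 < s * (S j \<omega> $ i)"
proof (cases "j \<le> m")
  case True
  have "s * s = 1" using s by (metis abs_mult_self_eq mult_1)
  then show ?thesis using True st j by (simp add: straight_def axis_def flip: mult.assoc)
next
  case False
  have "s = 1 \<or> s = - 1" using s by linarith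
  have "int m - int r \<le> s * (S (m + r) \<omega> $ i)" for r
  proof (induction r)
    case 0
    have "s * s = 1" using s by (metis abs_mult_self_eq mult_1)
    then show ?case using st by (simp add: straight_end axis_def flip: mult.assoc)
  next
    case (Suc r)
    have "\<bar>(S (Suc (m + r)) \<omega> - S (m + r) \<omega>) $ i\<bar> \<le> 1"
      using le abs_component_le_l1_norm order_trans by blast
    then have "s * (S (m + r) \<omega> $ i) - 1 \<le> s * (S (Suc (m + r)) \<omega> $ i)"
      using \<open>s = 1 \<or> s = - 1\<close> by auto
    then show ?case using Suc by simp
  qed
  from this[of "j - m"] show ?thesis using False j by simp
qed

lemma emeasure_straight_at_le:
  assumes C: "\<And>k (z :: int ^ 'd). heat k z \<le> C * (real k + 1) powr (- \<alpha>)" and s: "\<bar>s\<bar> = 1" and j: "m \<le> j"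
  shows "emeasure M {\<omega> \<in> space M. straight i s m \<omega> \<and> S j \<omega> = z} \<le>
    ennreal ((1 / (2 * real CARD('d) + 1)) ^ m) * ennreal (C * (real (j - m) + 1) powr (- \<alpha>))"
proof -
  have "emeasure M {\<omega> \<in> space M. straight i s m \<omega> \<and> S (m + (j - m)) \<omega> = z} =
      emeasure M {\<omega> \<in> space M. straight i s m \<omega>} * ennreal (heat (j - m) (z - axis i (s * int m)))"
    by (intro emeasure_transition past_straight straight_end)
  then show ?thesis
    using j unfolding prob_straight[OF s] by (simp del: of_nat_diff add: mult_left_mono ennreal_leI C)
qed

lemma nn_integral_straight_at:
  assumes s: "\<bar>s\<bar> = 1"
  shows "(\<integral>\<^sup>+z. emeasure M {\<omega> \<in> space M. straight i s m \<omega> \<and> S j \<omega> = z} \<partial>count_space UNIV) =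
    ennreal ((1 / (2 * real CARD('d) + 1)) ^ m)"
proof -
  have "(\<integral>\<^sup>+z. emeasure M {\<omega> \<in> space M. straight i s m \<omega> \<and> S j \<omega> = z} \<partial>count_space UNIV) =
      emeasure M (\<Union>z. {\<omega> \<in> space M. straight i s m \<omega> \<and> S j \<omega> = z})"
    unfolding straight_def by (intro emeasure_UN_countable[symmetric]) (auto simp: disjoint_family_on_def)
  also have "(\<Union>z. {\<omega> \<in> space M. straight i s m \<omega> \<and> S j \<omega> = z}) = {\<omega> \<in> space M. straight i s m \<omega>}"
    by auto
  finally show ?thesis by (simp add: prob_straight[OF s])
qed

end

text \<open>A return of one path to \<open>0\<close> would meet the start of the other, so
  \<open>meet\<close> also forbids returns: both local times at \<open>0\<close> are 1, and every
  other site is missed by one of the paths.\<close>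

lemma zeta_int_eq_1:
  assumes "x 0 = 0" "y 0 = 0" and meet: "\<And>j k. x j = y k \<Longrightarrow> j = 0 \<and> k = 0"
  shows "zeta_int q x y = 1"
proof -
  have x0: "(indicator {0} (x k) :: ennreal) = indicator {0} k"
    and y0: "(indicator {0} (y k) :: ennreal) = indicator {0} k" for k
    using meet[of k 0] meet[of 0 k] assms(1,2) by (auto simp: indicator_def)
  have 1: "local_time x 0 = 1" "local_time y 0 = 1"
    by (simp_all add: local_time_eq_nn_integral x0 y0)
  have "local_time x z * ennpowr (local_time y z) (q - 1) = indicator {0} z" for z
  proof (cases "z = 0")
    case False
    have "(\<forall>j. x j \<noteq> z) \<or> (\<forall>k. y k \<noteq> z)"
      using meet False assms(1) by metis
    then have "local_time x z = 0 \<or> local_time y z = 0"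
      by (auto simp: local_time_def)
    then show ?thesis using False by auto
  qed (simp add: 1)
  then show ?thesis by (simp add: zeta_int_def)
qed

lemma path_event_sets:
  fixes f :: "nat \<Rightarrow> 'b :: countable"
  shows "{x \<in> space (PiM UNIV (\<lambda>_. count_space UNIV)). \<forall>j\<le>m. x j = f j} \<in> sets (PiM UNIV (\<lambda>_. count_space UNIV))"
    and "{x \<in> space (PiM UNIV (\<lambda>_. count_space UNIV)). (\<forall>j\<le>m. x j = f j) \<and> x k = z} \<in> sets (PiM UNIV (\<lambda>_. count_space UNIV))"
  by measurable

section \<open>Meetings of the two independent walks\<close>

context two_walks
begin

lemma emeasure_indep_events:
  assumes A: "A \<in> sets (PiM UNIV (\<lambda>_. count_space UNIV))" and B: "B \<in> sets (PiM UNIV (\<lambda>_. count_space UNIV))"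
  shows "emeasure M {\<omega> \<in> space M. (\<lambda>n. S n \<omega>) \<in> A \<and> (\<lambda>n. S' n \<omega>) \<in> B} =
    emeasure M {\<omega> \<in> space M. (\<lambda>n. S n \<omega>) \<in> A} * emeasure M {\<omega> \<in> space M. (\<lambda>n. S' n \<omega>) \<in> B}"
proof -
  have [measurable]: "(\<lambda>\<omega> n. S n \<omega>) \<in> M \<rightarrow>\<^sub>M PiM UNIV (\<lambda>_. count_space UNIV)"
    "(\<lambda>\<omega> n. S' n \<omega>) \<in> M \<rightarrow>\<^sub>M PiM UNIV (\<lambda>_. count_space UNIV)"
    using indep_paths by (auto simp: indep_var_distribution_eq)
  note [measurable] = A B
  have "emeasure M {\<omega> \<in> space M. (\<lambda>n. S n \<omega>) \<in> A \<and> (\<lambda>n. S' n \<omega>) \<in> B} =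
      (\<integral>\<^sup>+\<omega>. indicator {\<omega> \<in> space M. (\<lambda>n. S n \<omega>) \<in> A \<and> (\<lambda>n. S' n \<omega>) \<in> B} \<omega> \<partial>M)"
    by (rule nn_integral_indicator[symmetric]) measurable
  also have "\<dots> = (\<integral>\<^sup>+\<omega>. indicator A (\<lambda>n. S n \<omega>) * indicator B (\<lambda>n. S' n \<omega>) \<partial>M)"
    by (intro nn_integral_cong) (auto split: split_indicator)
  also have "\<dots> = (\<integral>\<^sup>+\<omega>. indicator A (\<lambda>n. S n \<omega>) \<partial>M) * (\<integral>\<^sup>+\<omega>. indicator B (\<lambda>n. S' n \<omega>) \<partial>M)"
    by (rule indep_var_nn_integral_mult[OF indep_paths]) (simp_all add: A B)
  also have "(\<integral>\<^sup>+\<omega>. indicator A (\<lambda>n. S n \<omega>) \<partial>M) = (\<integral>\<^sup>+\<omega>. indicator {\<omega> \<in> space M. (\<lambda>n. S n \<omega>) \<in> A} \<omega> \<partial>M)"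
    by (intro nn_integral_cong) (auto split: split_indicator)
  also have "\<dots> = emeasure M {\<omega> \<in> space M. (\<lambda>n. S n \<omega>) \<in> A}"
    by (rule nn_integral_indicator) measurable
  also have "(\<integral>\<^sup>+\<omega>. indicator B (\<lambda>n. S' n \<omega>) \<partial>M) = (\<integral>\<^sup>+\<omega>. indicator {\<omega> \<in> space M. (\<lambda>n. S' n \<omega>) \<in> B} \<omega> \<partial>M)"
    by (intro nn_integral_cong) (auto split: split_indicator)
  also have "\<dots> = emeasure M {\<omega> \<in> space M. (\<lambda>n. S' n \<omega>) \<in> B}"
    by (rule nn_integral_indicator) measurable
  finally show ?thesis .
qed

definition opposite :: "'d \<Rightarrow> nat \<Rightarrow> 'a \<Rightarrow> bool" where
  "opposite i m \<omega> \<longleftrightarrow> S.straight i 1 m \<omega> \<and> S'.straight i (- 1) m \<omega>"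

lemma opposite_sets [measurable]: "{\<omega> \<in> space M. opposite i m \<omega>} \<in> sets M"
  unfolding opposite_def S.straight_def S'.straight_def by measurable

lemma emeasure_opposite:
  "emeasure M {\<omega> \<in> space M. opposite i m \<omega>} = ennreal ((1 / (2 * real CARD('d) + 1)) ^ (2 * m))"
proof -
  have "emeasure M {\<omega> \<in> space M. opposite i m \<omega>} =
      emeasure M {\<omega> \<in> space M. S.straight i 1 m \<omega>} * emeasure M {\<omega> \<in> space M. S'.straight i (- 1) m \<omega>}"
    using emeasure_indep_events[of "{x \<in> space (PiM UNIV (\<lambda>_. count_space UNIV)). \<forall>j\<le>m. x j = axis i (1 * int j)}"
        "{x \<in> space (PiM UNIV (\<lambda>_. count_space UNIV)). \<forall>j\<le>m. x j = axis i (- 1 * int j)}",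
        OF path_event_sets(1) path_event_sets(1)]
    by (simp add: opposite_def S.straight_def S'.straight_def space_PiM)
  also have "\<dots> = ennreal ((1 / (2 * real CARD('d) + 1)) ^ m) * ennreal ((1 / (2 * real CARD('d) + 1)) ^ m)"
    by (subst S.prob_straight, simp, subst S'.prob_straight, simp, rule refl)
  also have "\<dots> = ennreal ((1 / (2 * real CARD('d) + 1)) ^ (2 * m))"
    unfolding mult_2 power_add by (rule ennreal_mult[symmetric]) simp_all
  finally show ?thesis .
qed

text \<open>Sum over the meeting site. The walk observed at the later time is bounded uniformly in
  the site by the decay; the site probabilities of the other then sum to the probability of its
  straight run.\<close>

lemma emeasure_opposite_meet_le:
  assumes C: "\<And>k (z :: int ^ 'd). heat k z \<le> C * (real k + 1) powr (- \<alpha>)"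
    and jk: "m \<le> max j k"
  shows "emeasure M {\<omega> \<in> space M. opposite i m \<omega> \<and> S j \<omega> = S' k \<omega>} \<le>
    ennreal ((1 / (2 * real CARD('d) + 1)) ^ (2 * m)) * ennreal (C * (real (max j k - m) + 1) powr (- \<alpha>))"
proof -
  let ?a = "ennreal ((1 / (2 * real CARD('d) + 1)) ^ m)"
  let ?b = "ennreal (C * (real (max j k - m) + 1) powr (- \<alpha>))"
  let ?E = "\<lambda>z. emeasure M {\<omega> \<in> space M. S.straight i 1 m \<omega> \<and> S j \<omega> = z}"
  let ?E' = "\<lambda>z. emeasure M {\<omega> \<in> space M. S'.straight i (- 1) m \<omega> \<and> S' k \<omega> = z}"
  have prod: "emeasure M {\<omega> \<in> space M. (S.straight i 1 m \<omega> \<and> S j \<omega> = z) \<and> (S'.straight i (- 1) m \<omega> \<and> S' k \<omega> = z)} = ?E z * ?E' z" for z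
    using emeasure_indep_events[of "{x \<in> space (PiM UNIV (\<lambda>_. count_space UNIV)). (\<forall>j\<le>m. x j = axis i (1 * int j)) \<and> x j = z}"
        "{x \<in> space (PiM UNIV (\<lambda>_. count_space UNIV)). (\<forall>j\<le>m. x j = axis i (- 1 * int j)) \<and> x k = z}",
        OF path_event_sets(2) path_event_sets(2)]
    by (simp add: S.straight_def S'.straight_def space_PiM conj_assoc)
  have "emeasure M {\<omega> \<in> space M. opposite i m \<omega> \<and> S j \<omega> = S' k \<omega>} =
      emeasure M (\<Union>z. {\<omega> \<in> space M. (S.straight i 1 m \<omega> \<and> S j \<omega> = z) \<and> (S'.straight i (- 1) m \<omega> \<and> S' k \<omega> = z)})"
    by (intro arg_cong[where f = "emeasure M"]) (auto simp: opposite_def)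
  also have "\<dots> = (\<integral>\<^sup>+z. emeasure M {\<omega> \<in> space M. (S.straight i 1 m \<omega> \<and> S j \<omega> = z) \<and> (S'.straight i (- 1) m \<omega> \<and> S' k \<omega> = z)} \<partial>count_space UNIV)"
    unfolding S.straight_def S'.straight_def
    by (intro emeasure_UN_countable) (auto simp: disjoint_family_on_def)
  also have "\<dots> = (\<integral>\<^sup>+z. ?E z * ?E' z \<partial>count_space UNIV)"
    by (simp only: prod)
  also have "\<dots> \<le> ?a * ?b * ?a"
  proof (cases "k \<le> j")
    case True
    have "(\<integral>\<^sup>+z. ?E z * ?E' z \<partial>count_space UNIV) \<le> (\<integral>\<^sup>+z. (?a * ?b) * ?E' z \<partial>count_space UNIV)"
      using S.emeasure_straight_at_le[OF C, of 1 m j i] True jk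
      by (intro nn_integral_mono mult_right_mono) (auto simp: max_def)
    also have "\<dots> = (?a * ?b) * ?a"
      by (subst nn_integral_cmult) (simp_all add: S'.nn_integral_straight_at)
    finally show ?thesis .
  next
    case False
    have "(\<integral>\<^sup>+z. ?E z * ?E' z \<partial>count_space UNIV) \<le> (\<integral>\<^sup>+z. ?E z * (?a * ?b) \<partial>count_space UNIV)"
      using S'.emeasure_straight_at_le[OF C, of "- 1" m k i] False jk
      by (intro nn_integral_mono mult_left_mono) (auto simp: max_def)
    also have "\<dots> = ?a * (?a * ?b)"
      by (subst nn_integral_multc) (simp_all add: S.nn_integral_straight_at)
    finally show ?thesis by (simp only: mult_ac)
  qed
  also have "\<dots> = ennreal ((1 / (2 * real CARD('d) + 1)) ^ (2 * m)) * ?b"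
    unfolding mult_2 power_add by (subst ennreal_mult) (simp_all only: mult_ac, simp_all)
  finally show ?thesis .
qed

definition isolated_start :: "'a set" where
  "isolated_start = {\<omega> \<in> space M. S 0 \<omega> = 0 \<and> S' 0 \<omega> = 0 \<and> (\<forall>j k. S j \<omega> = S' k \<omega> \<longrightarrow> j = 0 \<and> k = 0)}"

lemma isolated_start_sets [measurable]: "isolated_start \<in> sets M"
  unfolding isolated_start_def by measurable

lemma zeta_gt_subset:
  assumes "1 \<le> t"
  shows "{\<omega> \<in> space M. zeta q (\<lambda>n. S n \<omega>) (\<lambda>n. S' n \<omega>) > ennreal t} \<subseteq> space M - isolated_start"
proof safe
  fix \<omega> assume gt: "ennreal t < zeta q (\<lambda>n. S n \<omega>) (\<lambda>n. S' n \<omega>)" and "\<omega> \<in> isolated_start"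
  then have "zeta_int q (\<lambda>n. S n \<omega>) (\<lambda>n. S' n \<omega>) = 1"
    by (intro zeta_int_eq_1) (auto simp: isolated_start_def)
  with zeta_le_zeta_int[of q "\<lambda>n. S n \<omega>" "\<lambda>n. S' n \<omega>"] have "zeta q (\<lambda>n. S n \<omega>) (\<lambda>n. S' n \<omega>) \<le> ennreal t"
    using assms by (metis ennreal_1 ennreal_leI order_trans)
  with gt show False by simp
qed

end

context two_walks
begin

text \<open>After an opposite run of \<open>m\<close> steps, meetings other than the common start
  can occur only when the later time \<open>n\<close> is at least \<open>2 * m\<close>. A union
  bound gives conditional probability at most \<open>h n\<close> for each such \<open>n\<close>, so
  at least half of the probability of the run remains.\<close>

lemma prob_isolated_start_ge:
  fixes C \<alpha> :: real and m :: nat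
  defines "h \<equiv> \<lambda>n. 2 * C * 2 powr \<alpha> * (real n + 1) powr (1 - \<alpha>)"
  assumes C: "0 \<le> C" "\<And>k (z :: int ^ 'd). heat k z \<le> C * (real k + 1) powr (- \<alpha>)"
    and \<alpha>: "0 \<le> \<alpha>"
    and h: "summable h" "(\<Sum>n. h (n + 2 * m)) \<le> 1 / 2"
  shows "(1 / (2 * real CARD('d) + 1)) ^ (2 * m) / 2 \<le> prob isolated_start"
proof -
  define a where "a = (1 / (2 * real CARD('d) + 1)) ^ (2 * m)"
  have a: "0 \<le> a" by (simp add: a_def)
  fix i :: 'd
  define meet where "meet = (\<lambda>(j, k). {\<omega> \<in> space M. opposite i m \<omega> \<and> S j \<omega> = S' k \<omega>})"
  have meet_sets [measurable]: "meet p \<in> sets M" for p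
    unfolding meet_def opposite_def S.straight_def S'.straight_def by (cases p) simp
  have meet_le: "prob (meet (j, k)) \<le> a * (C * (real (max j k - m) + 1) powr (- \<alpha>))" if "m \<le> max j k" for j k
    using emeasure_opposite_meet_le[OF C(2) that, of i] C(1) a
    by (simp add: meet_def emeasure_eq_measure ennreal_mult[symmetric] a_def[symmetric] del: of_nat_diff)
  \<comment> \<open>The pairs of times whose maximum is \<open>n\<close>; the pair
    \<open>(n, n)\<close> occurs in both images, which is harmless for an upper bound on the
    cardinality.\<close>
  define P where "P n = (\<lambda>j. (j, n)) ` {..n} \<union> (\<lambda>k. (n, k)) ` {..n}" for n :: nat
  have P: "finite (P n)" "card (P n) \<le> 2 * (n + 1)" "\<And>j k. (j, k) \<in> P n \<Longrightarrow> max j k = n" for n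
  proof -
    show "card (P n) \<le> 2 * (n + 1)"
      unfolding P_def by (rule order_trans[OF card_Un_le]) (simp add: card_image inj_on_def)
  qed (auto simp: P_def)
  define E where "E n = (\<Union>p\<in>P n. meet p)" for n
  have E_sets [measurable]: "E n \<in> sets M" for n
    unfolding E_def using P(1) by auto
  have E_le: "prob (E n) \<le> a * h n" if n: "2 * m \<le> n" for n
  proof -
    let ?b = "a * (C * (real (n - m) + 1) powr (- \<alpha>))"
    have "prob (E n) \<le> (\<Sum>p\<in>P n. prob (meet p))"
      unfolding E_def using P(1) by (intro finite_measure_subadditive_finite) auto
    also have "\<dots> \<le> (\<Sum>p\<in>P n. ?b)"
    proof (rule sum_mono)
      fix p assume "p \<in> P n"
      then obtain j k where "p = (j, k)" "max j k = n" using P(3) by (cases p) auto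
      then show "prob (meet p) \<le> ?b" using meet_le[of j k] n by simp
    qed
    also have "\<dots> \<le> real (2 * (n + 1)) * ?b"
      using P(2)[of n] a C(1) by (simp only: sum_constant) (intro mult_right_mono, auto)
    \<comment> \<open>From \<open>2 * m \<le> n\<close> it follows that \<open>n - m + 1\<close> is
      at least \<open>(n + 1) / 2\<close>; this halving is the source of
      \<open>2 powr \<alpha>\<close> in \<open>h\<close>.\<close>
    also have "\<dots> \<le> real (2 * (n + 1)) * (a * (C * ((real n + 1) / 2) powr (- \<alpha>)))"
      using n a C(1) \<alpha> by (intro mult_left_mono powr_mono2') auto
    also have "\<dots> = a * h n"
      by (simp add: h_def powr_divide powr_minus powr_diff field_simps)
    finally show ?thesis .
  qed
  let ?U = "\<Union>n. E (n + 2 * m)"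
  have U: "prob ?U \<le> a / 2"
  proof -
    have sh: "summable (\<lambda>n. a * h (n + 2 * m))"
      using h(1) by (intro summable_mult) (simp add: summable_iff_shift)
    have le: "prob (E (n + 2 * m)) \<le> a * h (n + 2 * m)" for n by (rule E_le) simp
    have sE: "summable (\<lambda>n. prob (E (n + 2 * m)))"
      by (rule summable_comparison_test'[OF sh, of 0]) (simp add: le)
    have "prob ?U \<le> (\<Sum>n. prob (E (n + 2 * m)))"
      using sE by (intro finite_measure_subadditive_countably) auto
    also have "\<dots> \<le> (\<Sum>n. a * h (n + 2 * m))"
      by (intro suminf_le le sE sh)
    also have "\<dots> = a * (\<Sum>n. h (n + 2 * m))"
      using h(1) by (intro suminf_mult) (simp add: summable_iff_shift)
    also have "\<dots> \<le> a * (1 / 2)"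
      using h(2) a by (rule mult_left_mono)
    finally show ?thesis by simp
  qed
  have "AE \<omega> in M. opposite i m \<omega> \<longrightarrow> \<omega> \<in> isolated_start \<union> ?U"
    using S.AE_step_le S'.AE_step_le AE_space
  proof eventually_elim
    case (elim \<omega>)
    have "\<omega> \<in> ?U" if opp: "opposite i m \<omega>" and "\<omega> \<notin> isolated_start"
    proof -
      have st: "S.straight i 1 m \<omega>" "S'.straight i (- 1) m \<omega>"
        using opp by (auto simp: opposite_def)
      have ax: "(axis i 0 :: int ^ 'd) = 0" by (simp add: axis_eq_0_iff)
      have z: "S 0 \<omega> = 0" "S' 0 \<omega> = 0"
        using st by (auto simp: S.straight_def S'.straight_def ax dest: spec[of _ 0])
      then obtain j k where jk: "S j \<omega> = S' k \<omega>" "j \<noteq> 0 \<or> k \<noteq> 0"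
        using \<open>\<omega> \<notin> isolated_start\<close> elim by (auto simp: isolated_start_def)
      have "2 * m \<le> max j k"
      proof (rule ccontr)
        assume "\<not> 2 * m \<le> max j k"
        then have "j < 2 * m" "k < 2 * m" by auto
        \<comment> \<open>At positive times before \<open>2 * m\<close> the walks lie strictly on
          opposite sides of the hyperplane, and at time \<open>0\<close> they lie on it, so only the
          common start is shared.\<close>
        then have "0 < j \<Longrightarrow> 0 < S j \<omega> $ i" "0 < k \<Longrightarrow> S' k \<omega> $ i < 0"
          using S.straight_positive[OF st(1) elim(1), of j] S'.straight_positive[OF st(2) elim(2), of k] by auto
        then show False
          using jk z by (cases "j = 0"; cases "k = 0") auto
      qed
      moreover have "(j, k) \<in> P (max j k)"
        by (auto simp: P_def max_def)
      ultimately have "\<omega> \<in> E (max j k - 2 * m + 2 * m)"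
        using jk opp elim unfolding E_def meet_def by force
      then show ?thesis by blast
    qed
    then show ?case by blast
  qed
  then have "prob {\<omega> \<in> space M. opposite i m \<omega>} \<le> prob (isolated_start \<union> ?U)"
    by (intro finite_measure_mono_AE) auto
  also have "\<dots> \<le> prob isolated_start + prob ?U"
    by (intro measure_Un_le) auto
  also have "prob {\<omega> \<in> space M. opposite i m \<omega>} = a"
    using emeasure_opposite[of i m] a by (simp add: emeasure_eq_measure a_def)
  finally show ?thesis
    using U unfolding a_def by simp
qed

end

section \<open>Combining the bounds for large and small \<open>t\<close>\<close>

theorem lemma1p4:
  fixes q :: real
  assumes "5 \<le> CARD('d::finite)"
    and "real CARD('d) / (real CARD('d) - 2) < q" and "q \<le> 2"
  shows "\<exists>\<kappa>>0. \<forall>(M :: 'a measure) (S :: nat \<Rightarrow> 'a \<Rightarrow> int ^ 'd) (S' :: nat \<Rightarrow> 'a \<Rightarrow> int ^ 'd).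
           two_indep_srw M S S' \<longrightarrow>
           (\<forall>t::real. t \<ge> 1 \<longrightarrow>
              measure M {\<omega> \<in> space M. zeta q (\<lambda>n. S n \<omega>) (\<lambda>n. S' n \<omega>) > ennreal t}
                \<le> exp (- \<kappa> * t powr (1 / q)))"
proof -
  define d where "d = real CARD('d)"
  have d: "5 \<le> d" using assms(1) by (simp add: d_def)
  have "1 < d / (d - 2)" using d by simp
  then have q: "1 < q" using assms(2) by (simp add: d_def)
  obtain C where C: "1 \<le> C" "\<And>k (z :: int ^ 'd). heat k z \<le> C * (real k + 1) powr (- (d / 2))"
    using heat_decay[where 'd = 'd] by (auto simp: d_def)

  let ?G = "\<integral>\<^sup>+z. ennpowr (green (z :: int ^ 'd)) q \<partial>count_space UNIV"
  have "?G < \<top>"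
    using assms by (intro nn_integral_green_powr_less_top) auto
  then obtain g where "?G = ennreal g" "0 \<le> g" by (cases ?G) auto
  \<comment> \<open>Adding 1 secures the strict positivity that \<open>prob_zeta_gt_le\<close> asks
    for.\<close>
  then have K: "?G \<le> ennreal (g + 1)" "0 < g + 1" by auto
  define c where "c = (1 / (exp 1 * (g + 1))) powr (1 / q)"
  have c: "0 < c" using K by (simp add: c_def)

  define h where "h = (\<lambda>n. 2 * C * 2 powr (d / 2) * (real n + 1) powr (1 - d / 2))"
  \<comment> \<open>Here the dimension matters: for \<open>d\<close> at least 5 the exponent
    \<open>1 - d / 2\<close> is at most \<open>-3/2\<close>, so the tail of \<open>h\<close> can be
    brought below \<open>1/2\<close>.\<close>
  have "summable (\<lambda>n. of_nat (Suc n) powr (1 - d / 2))"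
    using d by (subst summable_Suc_iff) (simp add: summable_real_powr_iff)
  then have h: "summable h"
    unfolding h_def by (intro summable_mult) (simp add: add_ac)
  then obtain m where "\<And>n. m \<le> n \<Longrightarrow> norm (\<Sum>i. h (i + n)) < 1 / 2"
    using suminf_exist_split[of "1 / 2" h] by auto
  from this[of "2 * m"] have m: "(\<Sum>i. h (i + 2 * m)) \<le> 1 / 2" by simp
  define \<delta> where "\<delta> = (1 / (2 * real CARD('d) + 1)) ^ (2 * m) / 2"
  have \<delta>: "0 < \<delta>" "\<delta> < 1"
  proof -
    have "(1 / (2 * real CARD('d) + 1)) ^ (2 * m) \<le> 1"
      by (intro power_le_one) auto
    then show "\<delta> < 1" by (simp add: \<delta>_def)
  qed (simp add: \<delta>_def add_nonneg_pos)
  define l where "l = - ln (1 - \<delta>)"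
  have l: "0 < l" "1 - \<delta> = exp (- l)" using \<delta> by (auto simp: l_def)

  \<comment> \<open>With \<open>s = t powr (1 / q)\<close>, the two bounds are separated at
    \<open>c * s = 2\<close>. From there on \<open>1 - c * s \<le> - c * s / 2\<close>; below it
    \<open>l * c * s / 2 \<le> l\<close>, so the constant bound \<open>exp (- l)\<close>
    suffices.\<close>
  define \<kappa> where "\<kappa> = min (c / 2) (l * c / 2)"
  have \<kappa>: "0 < \<kappa>" using c l by (simp add: \<kappa>_def)
  have "measure M {\<omega> \<in> space M. zeta q (\<lambda>n. S n \<omega>) (\<lambda>n. S' n \<omega>) > ennreal t} \<le> exp (- \<kappa> * t powr (1 / q))"
    if walks: "two_indep_srw M S S'" and t: "1 \<le> t"
    for M :: "'a measure" and S S' :: "nat \<Rightarrow> 'a \<Rightarrow> int ^ 'd" and t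
  proof -
    interpret prob_space M
      using walks by (simp add: two_indep_srw_def aperiodic_srw_def)
    interpret two_walks M S S'
      by unfold_locales (rule walks)
    let ?p = "prob {\<omega> \<in> space M. zeta q (\<lambda>n. S n \<omega>) (\<lambda>n. S' n \<omega>) > ennreal t}"
    define s where "s = t powr (1 / q)"
    have s: "0 \<le> s" by (simp add: s_def)
    have "?p \<le> exp (1 - (t / (exp 1 * (g + 1))) powr (1 / q))"
      using q assms(3) K t by (intro prob_zeta_gt_le) auto
    also have "(t / (exp 1 * (g + 1))) powr (1 / q) = c * s"
      using t K by (simp add: c_def s_def powr_divide)
    finally have large: "?p \<le> exp (1 - c * s)" .
    have "?p \<le> prob (space M - isolated_start)"
      using t by (intro finite_measure_mono zeta_gt_subset) auto
    also have "\<dots> = 1 - prob isolated_start"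
      by (rule prob_compl) simp
    also have "\<dots> \<le> 1 - \<delta>"
      using prob_isolated_start_ge[of C "d / 2" m] C d h m by (simp add: h_def \<delta>_def)
    finally have small: "?p \<le> exp (- l)" using l by simp
    show ?thesis
    proof (cases "2 \<le> c * s")
      case True
      have "\<kappa> * s \<le> c / 2 * s" using s by (intro mult_right_mono) (auto simp: \<kappa>_def)
      then have "1 - c * s \<le> - \<kappa> * s" using True by simp
      then show ?thesis using large by (simp add: s_def order_trans)
    next
      case False
      have "\<kappa> * s \<le> l * c / 2 * s" using s by (intro mult_right_mono) (auto simp: \<kappa>_def)
      also have "\<dots> = l * (c * s / 2)" by simp
      also have "\<dots> \<le> l * 1" using False l by (intro mult_left_mono) auto
      finally have "- l \<le> - \<kappa> * s" by simp
      then show ?thesis using small by (simp add: s_def order_trans)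
    qed
  qed
  with \<kappa> show ?thesis by blast
qed

end
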